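(* Let $K=\mathbf{Q}(\sqrt{-3})$, $\omega=\exp(2\pi i/3)$, $\mathcal{O}=\mathbf{Z}[\omega]$, $\lambda=\omega-\omega^2=\sqrt{-3}$, and for $\alpha\in K$ let $T(\alpha)=\alpha+\overline{\alpha}$. For $\alpha\in\mathcal{O}$ let $\chi(\alpha)=\omega^a$, where $a\in\mathbf{Z}$ satisfies $\alpha\equiv a\pmod{\lambda\mathcal{O}}$. For integers $k$ define the formal series $$a(q,z,w)=\sum_{\alpha\in\mathcal{O}}q^{|\alpha|^2}z^{T(\alpha)}w^{T(\alpha/\lambda)},\qquad b_k(q,z,w)=\sum_{\alpha\in\mathcal{O}}\chi(\alpha)^kq^{|\alpha|^2}z^{T(\alpha)}w^{T(\alpha/\lambda)},$$ $$c_k(q,z,w)=\sum_{\alpha\in\mathcal{O}+k/\lambda}q^{|\alpha|^2}z^{T(\alpha)}w^{T(\alpha/\lambda)},$$ and set $a(q)=a(q,1,1)$, $b(q)=b_1(q,1,1)$, $c(q)=c_1(q,1,1)$. Then for each integer $k$, $$3c_k(q,z,w)^3=a(q,w,z^{-3})a(q)^2+\omega^k b_1(q,w,z^{-3})b(q)^2+\omega^{-k}b_{-1}(q,w,z^{-3})b(q)^2+c_1(q,w,z^{-3})c(q)^2+c_{-1}(q,w,z^{-3})c(q)^2.$$ In particular $$3a(q,z,w)^3=a(q,w,z^{-3})a(q)^2+b_1(q,w,z^{-3})b(q)^2+b_{-1}(q,w,z^{-3})b(q)^2+c_1(q,w,z^{-3})c(q)^2+c_{-1}(q,w,z^{-3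})c(q)^2.$$
   Context: $\chi$ is well defined since $\mathbf{Z}\to\mathcal{O}$ induces an isomorphism $\mathbf{Z}/3\mathbf{Z}\cong\mathcal{O}/\lambda\mathcal{O}$. The series are formal series in $q,z,w$ with rational exponents; e.g. $a(q,w,z^{-3})$ denotes $\sum_{\alpha\in\mathcal{O}}q^{|\alpha|^2}w^{T(\alpha)}z^{-3T(\alpha/\lambda)}$, and similarly for $b_{\pm1}(q,w,z^{-3})$, $c_{\pm1}(q,w,z^{-3})$. Note $c_0=a$, $b_0=a$, and $b_k,c_k$ depend only on $k$ mod $3$. *)

theory Defs
  imports "HOL-Analysis.Analysis" "HOL-Library.Product_Plus"
begin

section \<open>Formal series in \<open>q, z, w\<close> with rational exponents\<close>

text \<open>
  The triple \<open>(n, i, j)\<close> encodes the monomial \<open>q\<^sup>n z\<^sup>i w\<^sup>j\<close>. The encoding is additive: the product of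
  monomials is \<open>+\<close>, the monomial \<open>1\<close> is \<open>0\<close>, and the power \<open>m\<^sup>r\<close> is \<open>mpow m r\<close>.
\<close>

type_synonym monomial = "rat \<times> rat \<times> rat"

definition var_q :: monomial where "var_q = (1, 0, 0)"
definition var_z :: monomial where "var_z = (0, 1, 0)"
definition var_w :: monomial where "var_w = (0, 0, 1)"
definition unit_mon :: monomial where "unit_mon = 0"

definition mpow :: "monomial \<Rightarrow> rat \<Rightarrow> monomial" where
  "mpow m r = (case m of (n, i, j) \<Rightarrow> (r * n, r * i, r * j))"

lemma fst_mpow [simp]: "fst (mpow m r) = r * fst m"
  by (simp add: mpow_def split: prod.splits)

text \<open>
  A formal series is a coefficient function with only finitely many monomials of \<open>q\<close>-degree at most
  \<open>N\<close>, for every \<open>N\<close>. This is what makes the Cauchy product a finite sum.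
\<close>

definition qfin :: "(monomial \<Rightarrow> complex) \<Rightarrow> bool" where
  "qfin f \<longleftrightarrow> (\<forall>N. finite {m. f m \<noteq> 0 \<and> fst m \<le> N})"

typedef qseries = "{f :: monomial \<Rightarrow> complex. qfin f}"
  morphisms qcoeff Abs_qseries
  by (rule exI[of _ "\<lambda>_. 0"]) (simp add: qfin_def)

setup_lifting type_definition_qseries

lemma qfin_qcoeff: "finite {m. qcoeff f m \<noteq> 0 \<and> fst m \<le> N}"
  using qcoeff[of f] by (simp add: qfin_def)

lemma qseries_eqI: "(\<And>m. qcoeff f m = qcoeff g m) \<Longrightarrow> f = g"
  by (metis qcoeff_inject ext)

lemma qfin_bdd_below:
  assumes "qfin f"
  obtains B where "\<And>m. f m \<noteq> 0 \<Longrightarrow> B \<le> fst m"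
proof -
  let ?S = "{m. f m \<noteq> 0 \<and> fst m \<le> 0}"
  have fin: "finite (insert 0 (fst ` ?S))"
    using assms by (auto simp: qfin_def)
  have "Min (insert 0 (fst ` ?S)) \<le> fst m" if "f m \<noteq> 0" for m
  proof (cases "fst m \<le> 0")
    case True
    then show ?thesis using that fin by (intro Min_le) auto
  next
    case False
    moreover have "Min (insert 0 (fst ` ?S)) \<le> 0" by (rule Min_le[OF fin]) simp
    ultimately show ?thesis by linarith
  qed
  then show ?thesis using that by blast
qed

definition conv :: "(monomial \<Rightarrow> complex) \<Rightarrow> (monomial \<Rightarrow> complex) \<Rightarrow> monomial \<Rightarrow> complex" where
  "conv f g e = (\<Sum>(a, b) | a + b = e \<and> f a \<noteq> 0 \<and> g b \<noteq> 0. f a * g b)"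

lemma conv_eq:
  assumes "finite A" "finite B"
    and "\<And>a b. a + b = e \<Longrightarrow> f a \<noteq> 0 \<Longrightarrow> g b \<noteq> 0 \<Longrightarrow> a \<in> A \<and> b \<in> B"
  shows "conv f g e = (\<Sum>a\<in>A. \<Sum>b\<in>B. if a + b = e then f a * g b else 0)"
proof -
  have "(\<Sum>a\<in>A. \<Sum>b\<in>B. if a + b = e then f a * g b else 0)
      = (\<Sum>p\<in>A \<times> B. if fst p + snd p = e then f (fst p) * g (snd p) else 0)"
    by (simp add: sum.cartesian_product case_prod_beta)
  also have "\<dots> = (\<Sum>p | fst p + snd p = e \<and> f (fst p) \<noteq> 0 \<and> g (snd p) \<noteq> 0. f (fst p) * g (snd p))"
    using assms by (intro sum.mono_neutral_cong_right) auto
  finally show ?thesis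
    by (simp add: conv_def case_prod_unfold)
qed

lemma qfin_bound:
  assumes "qfin f" "qfin g"
  obtains A B where "finite A" "finite B"
    "\<And>a b. fst (a + b) \<le> N \<Longrightarrow> f a \<noteq> 0 \<Longrightarrow> g b \<noteq> 0 \<Longrightarrow> a \<in> A \<and> b \<in> B"
proof -
  obtain F where F: "\<And>m. f m \<noteq> 0 \<Longrightarrow> F \<le> fst m" using qfin_bdd_below[OF assms(1)] by blast
  obtain G where G: "\<And>m. g m \<noteq> 0 \<Longrightarrow> G \<le> fst m" using qfin_bdd_below[OF assms(2)] by blast
  show ?thesis
  proof (rule that[of "{m. f m \<noteq> 0 \<and> fst m \<le> N - G}" "{m. g m \<noteq> 0 \<and> fst m \<le> N - F}"])
    fix a b :: monomial
    assume *: "fst (a + b) \<le> N" "f a \<noteq> 0" "g b \<noteq> 0"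
    then show "a \<in> {m. f m \<noteq> 0 \<and> fst m \<le> N - G} \<and> b \<in> {m. g m \<noteq> 0 \<and> fst m \<le> N - F}"
      using F[of a] G[of b] by simp
  qed (use assms in \<open>auto simp: qfin_def\<close>)
qed

lemma conv_nonzeroD:
  assumes "conv f g e \<noteq> 0"
  obtains a b where "a + b = e" "f a \<noteq> 0" "g b \<noteq> 0"
proof -
  have "\<exists>a b. a + b = e \<and> f a \<noteq> 0 \<and> g b \<noteq> 0"
  proof (rule ccontr)
    assume "\<not> ?thesis"
    then have empty: "{p. fst p + snd p = e \<and> f (fst p) \<noteq> 0 \<and> g (snd p) \<noteq> 0} = {}" by blast
    show False using assms unfolding conv_def case_prod_unfold empty by simp
  qed
  then show ?thesis using that by blast
qed

lemma qfin_conv: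
  assumes "qfin f" "qfin g"
  shows "qfin (conv f g)"
  unfolding qfin_def
proof
  fix N
  obtain A B where AB: "finite A" "finite B"
    "\<And>a b. fst (a + b) \<le> N \<Longrightarrow> f a \<noteq> 0 \<Longrightarrow> g b \<noteq> 0 \<Longrightarrow> a \<in> A \<and> b \<in> B"
    using qfin_bound[OF assms, where N = N] by metis
  have "{m. conv f g m \<noteq> 0 \<and> fst m \<le> N} \<subseteq> (\<lambda>(a, b). a + b) ` (A \<times> B)"
  proof
    fix m assume m: "m \<in> {m. conv f g m \<noteq> 0 \<and> fst m \<le> N}"
    then obtain a b where "a + b = m" "f a \<noteq> 0" "g b \<noteq> 0"
      using conv_nonzeroD by blast
    then show "m \<in> (\<lambda>(a, b). a + b) ` (A \<times> B)"
      using m AB(3)[of a b] by force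
  qed
  then show "finite {m. conv f g m \<noteq> 0 \<and> fst m \<le> N}"
    using AB finite_subset by blast
qed

lemma conv_commute: "conv f g = conv g f"
proof
  fix e
  show "conv f g e = conv g f e"
    unfolding conv_def
    by (rule sum.reindex_bij_witness[of _ prod.swap prod.swap])
       (auto simp: add.commute mult.commute)
qed

lemma conv_assoc:
  assumes "qfin f" "qfin g" "qfin h"
  shows "conv (conv f g) h e = conv f (conv g h) e"
proof -
  obtain U C where UC: "finite U" "finite C"
    "\<And>u c. fst (u + c) \<le> fst e \<Longrightarrow> conv f g u \<noteq> 0 \<Longrightarrow> h c \<noteq> 0 \<Longrightarrow> u \<in> U \<and> c \<in> C"
    using qfin_bound[OF qfin_conv[OF assms(1,2)] assms(3), where N = "fst e"] by metis
  obtain A V where AV: "finite A" "finite V"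
    "\<And>a v. fst (a + v) \<le> fst e \<Longrightarrow> f a \<noteq> 0 \<Longrightarrow> conv g h v \<noteq> 0 \<Longrightarrow> a \<in> A \<and> v \<in> V"
    using qfin_bound[OF assms(1) qfin_conv[OF assms(2,3)], where N = "fst e"] by metis
  obtain F where F: "\<And>m. f m \<noteq> 0 \<Longrightarrow> F \<le> fst m" using qfin_bdd_below[OF assms(1)] by blast
  obtain G where G: "\<And>m. g m \<noteq> 0 \<Longrightarrow> G \<le> fst m" using qfin_bdd_below[OF assms(2)] by blast
  obtain H where H: "\<And>m. h m \<noteq> 0 \<Longrightarrow> H \<le> fst m" using qfin_bdd_below[OF assms(3)] by blast
  define A' where "A' = {m. f m \<noteq> 0 \<and> fst m \<le> fst e - G - H}"
  define B' where "B' = {m. g m \<noteq> 0 \<and> fst m \<le> fst e - F - H}"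
  define C' where "C' = {m. h m \<noteq> 0 \<and> fst m \<le> fst e - F - G}"
  have fin: "finite A'" "finite B'" "finite C'"
    using assms by (auto simp: A'_def B'_def C'_def qfin_def)
  define U' where "U' = (\<lambda>(a, b). a + b) ` (A' \<times> B')"
  define V' where "V' = (\<lambda>(b, c). b + c) ` (B' \<times> C')"
  have finU: "finite U'" and finV: "finite V'"
    using fin by (auto simp: U'_def V'_def)
  have triple: "a \<in> A' \<and> b \<in> B' \<and> c \<in> C'"
    if "a + b + c = e" "f a \<noteq> 0" "g b \<noteq> 0" "h c \<noteq> 0" for a b c
    using that F[of a] G[of b] H[of c] by (auto simp: A'_def B'_def C'_def)
  have L: "conv (conv f g) h e = (\<Sum>u\<in>U'. \<Sum>c\<in>C'. if u + c = e then conv f g u * h c else 0)"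
  proof (rule conv_eq[OF finU fin(3)])
    fix u c assume *: "u + c = e" "conv f g u \<noteq> 0" "h c \<noteq> 0"
    then obtain a b where "a + b = u" "f a \<noteq> 0" "g b \<noteq> 0" using conv_nonzeroD by blast
    then show "u \<in> U' \<and> c \<in> C'" using triple[of a b c] * by (auto simp: U'_def)
  qed
  have R: "conv f (conv g h) e = (\<Sum>a\<in>A'. \<Sum>v\<in>V'. if a + v = e then f a * conv g h v else 0)"
  proof (rule conv_eq[OF fin(1) finV])
    fix a v assume *: "a + v = e" "f a \<noteq> 0" "conv g h v \<noteq> 0"
    then obtain b c where "b + c = v" "g b \<noteq> 0" "h c \<noteq> 0" using conv_nonzeroD by blast
    then show "a \<in> A' \<and> v \<in> V'" using triple[of a b c] * by (auto simp: V'_def add.assoc)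
  qed
  have L1: "(if u + c = e then conv f g u * h c else 0)
      = (\<Sum>a\<in>A'. \<Sum>b\<in>B'. if u = a + b then (if a + b + c = e then f a * g b * h c else 0) else 0)"
    if "c \<in> C'" for u c
  proof (cases "u + c = e")
    case True
    have "conv f g u = (\<Sum>a\<in>A'. \<Sum>b\<in>B'. if a + b = u then f a * g b else 0)"
    proof (rule conv_eq[OF fin(1,2)])
      fix a b assume "a + b = u" "f a \<noteq> 0" "g b \<noteq> 0"
      then show "a \<in> A' \<and> b \<in> B'" using triple[of a b c] True that by (auto simp: C'_def)
    qed
    then show ?thesis using True
      by (auto simp: sum_distrib_right intro!: sum.cong)
  next
    case False
    then show ?thesis by (subst if_not_P, assumption, intro sum.neutral[symmetric] ballI sum.neutral) auto
  qed
  have R1: "(if a + v = e then f a * conv g h v else 0)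
      = (\<Sum>b\<in>B'. \<Sum>c\<in>C'. if v = b + c then (if a + b + c = e then f a * g b * h c else 0) else 0)"
    if "a \<in> A'" for a v
  proof (cases "a + v = e")
    case True
    have "conv g h v = (\<Sum>b\<in>B'. \<Sum>c\<in>C'. if b + c = v then g b * h c else 0)"
    proof (rule conv_eq[OF fin(2,3)])
      fix b c assume "b + c = v" "g b \<noteq> 0" "h c \<noteq> 0"
      then show "b \<in> B' \<and> c \<in> C'" using triple[of a b c] True that by (auto simp: A'_def add.assoc)
    qed
    then show ?thesis using True
      by (auto simp: sum_distrib_left mult.assoc add.assoc intro!: sum.cong)
  next
    case False
    then show ?thesis
      by (subst if_not_P, assumption, intro sum.neutral[symmetric] ballI sum.neutral) (auto simp: add.assoc)
  qed
  let ?t = "\<lambda>a b c. if a + b + c = e then f a * g b * h c else 0"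
  have "conv (conv f g) h e
      = (\<Sum>u\<in>U'. \<Sum>c\<in>C'. \<Sum>a\<in>A'. \<Sum>b\<in>B'. if u = a + b then ?t a b c else 0)"
    unfolding L using L1 by (intro sum.cong refl) blast
  also have "\<dots> = (\<Sum>c\<in>C'. \<Sum>a\<in>A'. \<Sum>b\<in>B'. \<Sum>u\<in>U'. if u = a + b then ?t a b c else 0)"
    by (rule trans[OF sum.swap], rule sum.cong[OF refl], rule trans[OF sum.swap],
        rule sum.cong[OF refl], rule sum.swap)
  also have "\<dots> = (\<Sum>c\<in>C'. \<Sum>a\<in>A'. \<Sum>b\<in>B'. ?t a b c)"
    by (intro sum.cong refl) (use finU in \<open>auto simp: sum.delta U'_def\<close>)
  also have "\<dots> = (\<Sum>a\<in>A'. \<Sum>b\<in>B'. \<Sum>c\<in>C'. ?t a b c)"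
    by (rule trans[OF sum.swap], rule sum.cong[OF refl], rule sum.swap)
  also have "\<dots> = (\<Sum>a\<in>A'. \<Sum>b\<in>B'. \<Sum>c\<in>C'. \<Sum>v\<in>V'. if v = b + c then ?t a b c else 0)"
    by (intro sum.cong refl) (use finV in \<open>auto simp: sum.delta V'_def\<close>)
  also have "\<dots> = (\<Sum>a\<in>A'. \<Sum>v\<in>V'. \<Sum>b\<in>B'. \<Sum>c\<in>C'. if v = b + c then ?t a b c else 0)"
    by (rule sum.cong[OF refl], rule sym, rule trans[OF sum.swap], rule sum.cong[OF refl],
        rule sum.swap)
  also have "\<dots> = conv f (conv g h) e"
    unfolding R using R1 by (intro sum.cong refl) (metis (no_types, lifting))
  finally show ?thesis .
qed

lemma conv_distrib:
  assumes "qfin f" "qfin g" "qfin h"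
  shows "conv (\<lambda>m. f m + g m) h e = conv f h e + conv g h e"
proof -
  obtain A B where AB: "finite A" "finite B"
    "\<And>a b. fst (a + b) \<le> fst e \<Longrightarrow> f a \<noteq> 0 \<Longrightarrow> h b \<noteq> 0 \<Longrightarrow> a \<in> A \<and> b \<in> B"
    using qfin_bound[OF assms(1,3), where N = "fst e"] by metis
  obtain A' B' where AB': "finite A'" "finite B'"
    "\<And>a b. fst (a + b) \<le> fst e \<Longrightarrow> g a \<noteq> 0 \<Longrightarrow> h b \<noteq> 0 \<Longrightarrow> a \<in> A' \<and> b \<in> B'"
    using qfin_bound[OF assms(2,3), where N = "fst e"] by metis
  let ?A = "A \<union> A'" and ?B = "B \<union> B'"
  have fin: "finite ?A" "finite ?B" using AB AB' by auto
  have 1: "conv f h e = (\<Sum>a\<in>?A. \<Sum>b\<in>?B. if a + b = e then f a * h b else 0)"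
    by (rule conv_eq[OF fin]) (metis AB(3) UnI1 order_refl)
  have 2: "conv g h e = (\<Sum>a\<in>?A. \<Sum>b\<in>?B. if a + b = e then g a * h b else 0)"
    by (rule conv_eq[OF fin]) (metis AB'(3) UnI2 order_refl)
  have 3: "conv (\<lambda>m. f m + g m) h e
      = (\<Sum>a\<in>?A. \<Sum>b\<in>?B. if a + b = e then (f a + g a) * h b else 0)"
  proof (rule conv_eq[OF fin])
    fix a b assume *: "a + b = e" "f a + g a \<noteq> 0" "h b \<noteq> 0"
    then have "f a \<noteq> 0 \<or> g a \<noteq> 0" by auto
    then show "a \<in> ?A \<and> b \<in> ?B" using AB(3)[of a b] AB'(3)[of a b] * by blast
  qed
  show ?thesis unfolding 1 2 3 sum.distrib[symmetric]
    by (intro sum.cong refl) (simp add: algebra_simps)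
qed

lemma qfin_add: "qfin f \<Longrightarrow> qfin g \<Longrightarrow> qfin (\<lambda>m. f m + g m)"
  unfolding qfin_def
  by (intro allI, rule finite_subset[where B = "{m. f m \<noteq> 0 \<and> fst m \<le> N} \<union> {m. g m \<noteq> 0 \<and> fst m \<le> N}" for N])
     auto

lemma qfin_single: "qfin (\<lambda>m. if m = x then c else 0)"
  unfolding qfin_def by (intro allI, rule finite_subset[of _ "{x}"]) auto

lift_definition qmonom :: "complex \<Rightarrow> monomial \<Rightarrow> qseries" is "\<lambda>c x m. if m = x then c else 0"
  by (rule qfin_single)

definition qconst :: "complex \<Rightarrow> qseries" where
  "qconst c = qmonom c unit_mon"

instantiation qseries :: comm_ring_1
begin

lift_definition zero_qseries :: qseries is "\<lambda>_. 0" by (simp add: qfin_def)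
lift_definition one_qseries :: qseries is "\<lambda>m. if m = unit_mon then 1 else 0" by (rule qfin_single)
lift_definition plus_qseries :: "qseries \<Rightarrow> qseries \<Rightarrow> qseries" is "\<lambda>f g m. f m + g m"
  by (rule qfin_add)
lift_definition uminus_qseries :: "qseries \<Rightarrow> qseries" is "\<lambda>f m. - f m" by (simp add: qfin_def)
lift_definition minus_qseries :: "qseries \<Rightarrow> qseries \<Rightarrow> qseries" is "\<lambda>f g m. f m - g m"
  using qfin_add[where g = "\<lambda>m. - g m" for g] by (simp add: qfin_def)
lift_definition times_qseries :: "qseries \<Rightarrow> qseries \<Rightarrow> qseries" is conv
  by (rule qfin_conv)

instance
proof
  fix f g h :: qseries
  show "f + g + h = f + (g + h)" by transfer (simp add: add.assoc)
  show "f + g = g + f" by transfer (simp add: add.commute)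
  show "0 + f = f" by transfer simp
  show "- f + f = 0" by transfer simp
  show "f - g = f + - g" by transfer simp
  show "f * g * h = f * (g * h)" by transfer (auto simp: conv_assoc)
  show "f * g = g * f" by transfer (rule conv_commute)
  show "(f + g) * h = f * h + g * h" by transfer (auto simp: conv_distrib)
  show "(0::qseries) \<noteq> 1" by transfer (metis zero_neq_one)
  show "1 * f = f"
  proof transfer
    fix f :: "monomial \<Rightarrow> complex" assume "qfin f"
    show "conv (\<lambda>m. if m = unit_mon then 1 else 0) f = f"
    proof
      fix e
      have "conv (\<lambda>m. if m = unit_mon then 1 else 0) f e
          = (\<Sum>a\<in>{unit_mon}. \<Sum>b\<in>{e}. if a + b = e then (if a = unit_mon then 1 else 0) * f b else 0)"
        by (rule conv_eq) (auto simp: unit_mon_def split: if_splits)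
      then show "conv (\<lambda>m. if m = unit_mon then 1 else 0) f e = f e"
        by (simp add: unit_mon_def)
    qed
  qed
qed

end

lemma qcoeff_add: "qcoeff (f + g) m = qcoeff f m + qcoeff g m"
  by transfer simp

lemma qcoeff_mult:
  "qcoeff (f * g) m = (\<Sum>(a, b) | a + b = m \<and> qcoeff f a \<noteq> 0 \<and> qcoeff g b \<noteq> 0. qcoeff f a * qcoeff g b)"
  by transfer (simp add: conv_def)


section \<open>The field \<open>K\<close> and its ring of integers\<close>

definition omega :: complex where
  "omega = exp (2 * of_real pi * \<i> / 3)"

definition lam :: complex where
  "lam = omega - omega\<^sup>2"

definition K :: "complex set" where
  "K = {of_rat x + of_rat y * lam | x y. True}"

definition OK :: "complex set" where
  "OK = {of_int a + of_int b * omega | a b. True}"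

definition T :: "complex \<Rightarrow> complex" where
  "T \<alpha> = \<alpha> + cnj \<alpha>"

text \<open>The coset \<open>\<O> + k/\<lambda>\<close>.\<close>

definition OK_coset :: "int \<Rightarrow> complex set" where
  "OK_coset k = {\<beta> + of_int k / lam | \<beta>. \<beta> \<in> OK}"

definition chi :: "complex \<Rightarrow> complex" where
  "chi \<alpha> = omega powi (SOME a. \<exists>\<beta>\<in>OK. \<alpha> - of_int a = lam * \<beta>)"

text \<open>The rational number with a given real or complex value; only meaningful on rational values.\<close>

definition to_rat :: "'a :: field_char_0 \<Rightarrow> rat" where
  "to_rat x = (THE r. of_rat r = x)"

lemma to_rat_of_rat [simp]: "to_rat (of_rat r) = r"
  by (simp add: to_rat_def)

lemma omega_eq: "omega = Complex (- 1 / 2) (sqrt 3 / 2)"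
proof -
  have "omega = cis (2 * pi / 3)"
    by (simp add: omega_def cis_conv_exp mult_ac)
  then show ?thesis
    by (simp add: complex_eq_iff cos_120 sin_120)
qed

lemma lam_eq: "lam = Complex 0 (sqrt 3)"
  by (simp add: lam_def omega_eq complex_eq_iff power2_eq_square)

lemma lam_squared: "lam\<^sup>2 = - 3"
  by (simp add: lam_eq complex_eq_iff power2_eq_square)

lemma lam_nonzero: "lam \<noteq> 0"
  by (simp add: lam_eq complex_eq_iff)

lemma omega_conv_lam: "omega = (lam - 1) / 2"
  by (simp add: omega_eq lam_eq complex_eq_iff)

lemma omega_cubed: "omega ^ 3 = 1"
  by (simp add: omega_eq complex_eq_iff power3_eq_cube)

lemma of_rat_complex: "(of_rat u :: complex) = of_real (of_rat u)"
  by (cases u) (simp add: of_rat_rat)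

lemma K_Re_Im:
  assumes "x = of_rat r + of_rat s * lam"
  shows "Re x = of_rat r" "Im x = of_rat s * sqrt 3"
  using assms by (simp_all add: of_rat_complex lam_eq)

lemma OK_subset_K: "OK \<subseteq> K"
proof
  fix x assume "x \<in> OK"
  then obtain a b where "x = of_int a + of_int b * omega" by (auto simp: OK_def)
  then have "x = of_rat (of_int a - of_int b / 2) + of_rat (of_int b / 2) * lam"
    by (simp add: omega_conv_lam of_rat_diff of_rat_divide diff_divide_distrib algebra_simps)
  then show "x \<in> K" by (auto simp: K_def)
qed

lemma divide_lam_K:
  assumes "x \<in> K" shows "x / lam \<in> K"
proof -
  obtain r s where x: "x = of_rat r + of_rat s * lam" using assms by (auto simp: K_def)
  have inv: "inverse lam = - lam / 3"
    using lam_squared lam_nonzero by (simp add: field_simps power2_eq_square)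
  have "of_rat r / lam = of_rat (- r / 3) * lam"
    unfolding divide_inverse[of _ lam] inv by (simp add: of_rat_divide of_rat_minus)
  moreover have "x / lam = of_rat s + of_rat r / lam"
    using lam_nonzero by (simp add: x add_divide_distrib)
  ultimately have "x / lam = of_rat s + of_rat (- r / 3) * lam" by simp
  then show ?thesis by (auto simp: K_def)
qed

lemma OK_coset_subset_K: "OK_coset k \<subseteq> K"
proof
  fix x assume "x \<in> OK_coset k"
  then obtain \<beta> where \<beta>: "\<beta> \<in> OK" "x = \<beta> + of_int k / lam" by (auto simp: OK_coset_def)
  have "of_int k / lam \<in> K"
    by (rule divide_lam_K, unfold K_def, rule CollectI, rule exI[of _ "of_int k"], rule exI[of _ 0]) simp
  then obtain r s where 1: "of_int k / lam = of_rat r + of_rat s * lam" by (auto simp: K_def)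
  obtain r' s' where 2: "\<beta> = of_rat r' + of_rat s' * lam"
    using \<beta>(1) OK_subset_K by (auto simp: K_def)
  have "x = of_rat (r + r') + of_rat (s + s') * lam"
    by (simp add: \<beta> 1 2 of_rat_add algebra_simps)
  then show "x \<in> K" by (auto simp: K_def)
qed

lemma T_rat:
  assumes "x \<in> K" shows "of_rat (to_rat (T x)) = T x"
proof -
  obtain r s where "x = of_rat r + of_rat s * lam" using assms by (auto simp: K_def)
  then have "Re x = of_rat r" by (rule K_Re_Im)
  then have "T x = of_rat (2 * r)"
    by (simp add: T_def of_rat_complex complex_eq_iff of_rat_mult)
  then show ?thesis by simp
qed

lemma norm_squared_rat:
  assumes "x \<in> K" shows "of_rat (to_rat ((cmod x)\<^sup>2)) = (cmod x)\<^sup>2"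
proof -
  obtain r s where "x = of_rat r + of_rat s * lam" using assms by (auto simp: K_def)
  then have "(cmod x)\<^sup>2 = of_rat (r\<^sup>2 + 3 * s\<^sup>2)"
    using K_Re_Im[of x r s] by (simp add: cmod_power2 of_rat_add of_rat_mult of_rat_power power_mult_distrib)
  then show ?thesis by simp
qed

lemma int_lam_OK:
  assumes "of_int n = lam * \<beta>" "\<beta> \<in> OK"
  shows "3 dvd n"
proof -
  obtain a b where ab: "\<beta> = of_int a + of_int b * omega" using assms(2) by (auto simp: OK_def)
  have "Im (lam * \<beta>) = 0" "Re (lam * \<beta>) = of_int n"
    using assms(1) by (metis Im_complex_of_real of_real_of_int_eq, metis Re_complex_of_real of_real_of_int_eq)
  then have "2 * of_int a = (of_int b :: real)" "of_int n = - (3 / 2) * (of_int b :: real)"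
    by (auto simp: ab lam_eq omega_eq mult.left_commute[of "sqrt 3"])
  then have "of_int n = (of_int (3 * (- a)) :: real)" by simp
  then have "n = 3 * (- a)" by (simp only: of_int_eq_iff)
  then show ?thesis by simp
qed

lemma OK_diff: "\<alpha> \<in> OK \<Longrightarrow> \<beta> \<in> OK \<Longrightarrow> \<alpha> - \<beta> \<in> OK"
proof -
  assume "\<alpha> \<in> OK" "\<beta> \<in> OK"
  then obtain a b c d where "\<alpha> = of_int a + of_int b * omega" "\<beta> = of_int c + of_int d * omega"
    by (auto simp: OK_def)
  then have "\<alpha> - \<beta> = of_int (a - c) + of_int (b - d) * omega"
    by (simp add: algebra_simps)
  then show "\<alpha> - \<beta> \<in> OK" unfolding OK_def by blast
qed

lemma chi_eq:
  assumes "\<beta> \<in> OK" "\<alpha> - of_int a = lam * \<beta>"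
  shows "chi \<alpha> = omega powi a"
proof -
  define a' where "a' = (SOME a :: int. \<exists>\<beta>\<in>OK. \<alpha> - of_int a = lam * \<beta>)"
  have "\<exists>\<beta>\<in>OK. \<alpha> - of_int a' = lam * \<beta>"
    unfolding a'_def by (rule someI[where x = a]) (use assms in blast)
  then obtain \<beta>' where \<beta>': "\<beta>' \<in> OK" "\<alpha> - of_int a' = lam * \<beta>'" by blast
  have "of_int (a' - a) = lam * (\<beta> - \<beta>')"
    using assms(2) \<beta>'(2) by (simp add: algebra_simps)
  then have "3 dvd a' - a" using int_lam_OK OK_diff assms(1) \<beta>'(1) by blast
  then obtain j where "a' = a + 3 * j" by (metis dvd_def add.commute diff_add_cancel)
  moreover have "omega \<noteq> 0" by (simp add: omega_def)
  ultimately have "omega powi a' = omega powi a * (omega powi 3) powi j"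
    by (simp add: power_int_add power_int_mult)
  also have "omega powi 3 = 1" using omega_cubed by simp
  finally show ?thesis by (simp add: chi_def a'_def)
qed

lemma chi_exists:
  assumes "\<alpha> \<in> OK"
  shows "\<exists>a :: int. \<exists>\<beta>\<in>OK. \<alpha> - of_int a = lam * \<beta>"
proof -
  obtain a b where ab: "\<alpha> = of_int a + of_int b * omega" using assms by (auto simp: OK_def)
  define \<beta> where "\<beta> = of_int b + of_int b * omega"
  have "\<beta> \<in> OK" unfolding \<beta>_def OK_def by blast
  moreover have "\<alpha> - of_int (a + b) = lam * \<beta>"
    by (simp add: ab \<beta>_def lam_eq omega_eq complex_eq_iff)
  ultimately show ?thesis by blast
qed


section \<open>The theta series\<close>

text \<open>
  The arguments \<open>X, Y, Z\<close> of the series are monomials, so that specialisations such as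
  \<open>a(q, w, z\<^sup>-\<^sup>3)\<close> or \<open>a(q, 1, 1)\<close> are literally applications of one function.
\<close>

definition theta_mon :: "monomial \<Rightarrow> monomial \<Rightarrow> monomial \<Rightarrow> complex \<Rightarrow> monomial" where
  "theta_mon X Y Z \<alpha> =
     mpow X (to_rat ((cmod \<alpha>)\<^sup>2)) + mpow Y (to_rat (T \<alpha>)) + mpow Z (to_rat (T (\<alpha> / lam)))"

definition theta ::
  "complex set \<Rightarrow> (complex \<Rightarrow> complex) \<Rightarrow> monomial \<Rightarrow> monomial \<Rightarrow> monomial \<Rightarrow> qseries" where
  "theta S \<psi> X Y Z = Abs_qseries (\<lambda>m. \<Sum>\<alpha> | \<alpha> \<in> S \<and> theta_mon X Y Z \<alpha> = m. \<psi> \<alpha>)"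

definition ser_a :: "monomial \<Rightarrow> monomial \<Rightarrow> monomial \<Rightarrow> qseries" where
  "ser_a X Y Z = theta OK (\<lambda>_. 1) X Y Z"

definition ser_b :: "int \<Rightarrow> monomial \<Rightarrow> monomial \<Rightarrow> monomial \<Rightarrow> qseries" where
  "ser_b k X Y Z = theta OK (\<lambda>\<alpha>. chi \<alpha> powi k) X Y Z"

definition ser_c :: "int \<Rightarrow> monomial \<Rightarrow> monomial \<Rightarrow> monomial \<Rightarrow> qseries" where
  "ser_c k X Y Z = theta (OK_coset k) (\<lambda>_. 1) X Y Z"

definition a_q :: qseries where "a_q = ser_a var_q unit_mon unit_mon"
definition b_q :: qseries where "b_q = ser_b 1 var_q unit_mon unit_mon"
definition c_q :: qseries where "c_q = ser_c 1 var_q unit_mon unit_mon"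

text \<open>
  If \<open>X = q\<close> and \<open>Y, Z\<close> do not involve \<open>q\<close>, then the sums above are finite and \<open>Abs_qseries\<close> is
  applied inside its domain.
\<close>

lemma finite_OK_norm: "finite {\<alpha> \<in> OK. (cmod \<alpha>)\<^sup>2 \<le> N}"
proof -
  define M where "M = \<lceil>2 * N\<rceil>"
  have "{\<alpha> \<in> OK. (cmod \<alpha>)\<^sup>2 \<le> N}
      \<subseteq> (\<lambda>(a, b). of_int a + of_int b * omega) ` ({- M..M} \<times> {- M..M})"
  proof
    fix \<alpha> assume \<alpha>: "\<alpha> \<in> {\<alpha> \<in> OK. (cmod \<alpha>)\<^sup>2 \<le> N}"
    then obtain a b where ab: "\<alpha> = of_int a + of_int b * omega" by (auto simp: OK_def)
    have "(of_int a - of_int b / 2)\<^sup>2 + 3 / 4 * (of_int b)\<^sup>2 \<le> N"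
      using \<alpha> by (simp add: ab cmod_power2 omega_eq power_mult_distrib power_divide)
    moreover have "(of_int a - of_int b / 2)\<^sup>2 + 3 / 4 * (of_int b)\<^sup>2
        = (of_int b - of_int a / 2)\<^sup>2 + 3 / 4 * (of_int a :: real)\<^sup>2"
      by (simp add: power2_eq_square algebra_simps)
    ultimately have "3 / 4 * (of_int a)\<^sup>2 \<le> N" "3 / 4 * (of_int b)\<^sup>2 \<le> N"
      by (smt (verit) zero_le_power2)+
    moreover have "\<bar>x\<bar> \<le> M" if "3 / 4 * (of_int x)\<^sup>2 \<le> N" for x :: int
    proof -
      have "\<bar>x\<bar> \<le> x\<^sup>2"
      proof (cases "x = 0")
        case False
        then show ?thesis using self_le_power[of "\<bar>x\<bar>" 2] by simp
      qed simp
      then have "of_int \<bar>x\<bar> \<le> (of_int (x\<^sup>2) :: real)" by (simp only: of_int_le_iff)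
      then have "of_int \<bar>x\<bar> \<le> (of_int x)\<^sup>2 * (1 :: real)" by simp
      moreover have "0 \<le> N" using that by (rule order_trans[rotated]) simp
      ultimately have "of_int \<bar>x\<bar> \<le> 2 * N" using that by linarith
      then show ?thesis unfolding M_def by linarith
    qed
    ultimately show "\<alpha> \<in> (\<lambda>(a, b). of_int a + of_int b * omega) ` ({- M..M} \<times> {- M..M})"
      using ab by (force simp: abs_le_iff)
  qed
  then show ?thesis by (rule finite_subset) simp
qed

lemma OK_lam: "\<beta> \<in> OK \<Longrightarrow> lam * \<beta> + of_int k \<in> OK"
proof -
  assume "\<beta> \<in> OK"
  then obtain a b where ab: "\<beta> = of_int a + of_int b * omega" by (auto simp: OK_def)
  have "lam * \<beta> + of_int k = of_int (a - 2 * b + k) + of_int (2 * a - b) * omega"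
    by (simp add: ab lam_eq omega_eq complex_eq_iff algebra_simps)
  then show ?thesis unfolding OK_def by blast
qed

lemma finite_OK_coset_norm: "finite {\<alpha> \<in> OK_coset k. (cmod \<alpha>)\<^sup>2 \<le> N}"
proof -
  have "lam * \<alpha> \<in> {\<alpha> \<in> OK. (cmod \<alpha>)\<^sup>2 \<le> 3 * N}"
    if \<alpha>: "\<alpha> \<in> OK_coset k" "(cmod \<alpha>)\<^sup>2 \<le> N" for \<alpha>
  proof -
    obtain \<beta> where "\<beta> \<in> OK" "\<alpha> = \<beta> + of_int k / lam" using \<alpha>(1) by (auto simp: OK_coset_def)
    then have "lam * \<alpha> \<in> OK" using OK_lam[of \<beta> k] lam_nonzero by (simp add: distrib_left)
    moreover have "(cmod lam)\<^sup>2 = 3" by (simp add: cmod_power2 lam_eq)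
    ultimately show ?thesis using \<alpha> by (simp add: norm_mult power_mult_distrib)
  qed
  then have "(\<lambda>\<alpha>. lam * \<alpha>) ` {\<alpha> \<in> OK_coset k. (cmod \<alpha>)\<^sup>2 \<le> N} \<subseteq> {\<alpha> \<in> OK. (cmod \<alpha>)\<^sup>2 \<le> 3 * N}"
    by blast
  then have "finite ((\<lambda>\<alpha>. lam * \<alpha>) ` {\<alpha> \<in> OK_coset k. (cmod \<alpha>)\<^sup>2 \<le> N})"
    using finite_OK_norm finite_subset by blast
  then show ?thesis
    by (rule finite_imageD) (use lam_nonzero in \<open>auto simp: inj_on_def\<close>)
qed

lemma theta_wf:
  assumes S: "S = OK \<or> S = OK_coset k" and Y: "fst Y = 0" and Z: "fst Z = 0"
  shows "finite {\<alpha>. \<alpha> \<in> S \<and> theta_mon var_q Y Z \<alpha> = m}"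
    and "qcoeff (theta S \<psi> var_q Y Z) m = (\<Sum>\<alpha> | \<alpha> \<in> S \<and> theta_mon var_q Y Z \<alpha> = m. \<psi> \<alpha>)"
proof -
  let ?f = "\<lambda>m. \<Sum>\<alpha> | \<alpha> \<in> S \<and> theta_mon var_q Y Z \<alpha> = m. \<psi> \<alpha>"
  have SK: "S \<subseteq> K" using S OK_subset_K OK_coset_subset_K by auto
  have fst: "(cmod \<alpha>)\<^sup>2 = of_rat (fst (theta_mon var_q Y Z \<alpha>))" if "\<alpha> \<in> S" for \<alpha>
  proof -
    have "fst (theta_mon var_q Y Z \<alpha>) = to_rat ((cmod \<alpha>)\<^sup>2)"
      by (simp add: theta_mon_def Y Z) (simp add: var_q_def)
    then show ?thesis using norm_squared_rat[of \<alpha>] that SK by auto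
  qed
  have fin: "finite {\<alpha> \<in> S. (cmod \<alpha>)\<^sup>2 \<le> N}" for N
    using S finite_OK_norm finite_OK_coset_norm by auto
  show "finite {\<alpha>. \<alpha> \<in> S \<and> theta_mon var_q Y Z \<alpha> = m}"
    by (rule finite_subset[OF _ fin[of "of_rat (fst m)"]]) (auto simp: fst)
  have "qfin ?f"
    unfolding qfin_def
  proof
    fix N :: rat
    have "{m. ?f m \<noteq> 0 \<and> fst m \<le> N} \<subseteq> theta_mon var_q Y Z ` {\<alpha> \<in> S. (cmod \<alpha>)\<^sup>2 \<le> of_rat N}"
    proof
      fix m assume m: "m \<in> {m. ?f m \<noteq> 0 \<and> fst m \<le> N}"
      then have "{\<alpha>. \<alpha> \<in> S \<and> theta_mon var_q Y Z \<alpha> = m} \<noteq> {}"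
        by (metis (mono_tags, lifting) mem_Collect_eq sum.empty)
      then obtain \<alpha> where "\<alpha> \<in> S" "theta_mon var_q Y Z \<alpha> = m" by blast
      then show "m \<in> theta_mon var_q Y Z ` {\<alpha> \<in> S. (cmod \<alpha>)\<^sup>2 \<le> of_rat N}"
        using m fst[of \<alpha>] by (auto simp: of_rat_less_eq)
    qed
    then show "finite {m. ?f m \<noteq> 0 \<and> fst m \<le> N}"
      using fin finite_subset by blast
  qed
  then show "qcoeff (theta S \<psi> var_q Y Z) m = ?f m"
    by (simp add: theta_def Abs_qseries_inverse)
qed

end

theory Submission
  imports Defs
begin

text \<open>
  The cube of \<open>c\<^sub>k\<close> is a sum over triples \<open>(x, y, z)\<close> in \<open>\<O> + k/\<lambda>\<close>. The unitary Fourier transform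
  \<open>u = (x + y + z)/\<lambda>\<close>, \<open>v = (x + \<omega> y + \<omega>\<^sup>2 z)/\<lambda>\<close>, \<open>t = (x + \<omega>\<^sup>2 y + \<omega> z)/\<lambda>\<close> preserves
  \<open>|x|\<^sup>2 + |y|\<^sup>2 + |z|\<^sup>2\<close> and separates \<open>z\<close> and \<open>w\<close>, which now only see \<open>u\<close>. Its image consists of the triples
  that lie in one coset \<open>(\<O> + s/\<lambda>)\<^sup>3\<close>, with \<open>s \<in> {0, 1, -1}\<close>, and satisfy
  \<open>(u - s/\<lambda>) + (v - s/\<lambda>) + (t - s/\<lambda>) + k \<equiv> 0\<close> modulo \<open>\<lambda>\<close>. Detecting this congruence by the powers
  \<open>\<chi>\<^sup>j\<close>, \<open>j \<in> {0, 1, -1}\<close>, writes \<open>3 c\<^sub>k\<^sup>3\<close> as a sum of nine products of twisted theta series. The four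
  products with \<open>s, j \<noteq> 0\<close> vanish: at \<open>z = w = 1\<close> multiplication by \<open>\<omega>\<close> multiplies the twisted series
  by a nontrivial root of unity.
\<close>

section \<open>Series indexed by families of monomials\<close>

text \<open>Local finiteness makes every fibre sum finite. Nonnegative q-degrees let the condition
  pass to products: a bound on the degree of a sum then bounds both summands.\<close>

definition q_proper :: "'i set \<Rightarrow> ('i \<Rightarrow> monomial) \<Rightarrow> bool" where
  "q_proper I f \<longleftrightarrow> (\<forall>N. finite {i \<in> I. fst (f i) \<le> N}) \<and> (\<forall>i\<in>I. 0 \<le> fst (f i))"

text \<open>The formal sum of \<open>\<phi> i\<close> times the monomial \<open>f i\<close>, where
  several indices may share a monomial. With arbitrary index sets, identities between series reduce
  to bijections between sets of lattice points.\<close>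

definition family_series :: "'i set \<Rightarrow> ('i \<Rightarrow> monomial) \<Rightarrow> ('i \<Rightarrow> complex) \<Rightarrow> qseries" where
  "family_series I f \<phi> = Abs_qseries (\<lambda>m. \<Sum>i | i \<in> I \<and> f i = m. \<phi> i)"

lemma q_proper_finite: "q_proper I f \<Longrightarrow> finite {i. i \<in> I \<and> f i = m}"
  unfolding q_proper_def
  by (elim conjE allE[of _ "fst m"]) (erule finite_subset[rotated], auto)

lemma q_proper_subset: "q_proper I f \<Longrightarrow> J \<subseteq> I \<Longrightarrow> q_proper J f"
  unfolding q_proper_def by (auto elim!: finite_subset[rotated])

lemma q_proper_Times:
  assumes "q_proper I f" "q_proper J g"
  shows "q_proper (I \<times> J) (\<lambda>(i, j). f i + g j)"
  unfolding q_proper_def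
proof (intro conjI allI ballI)
  fix N
  have "{p \<in> I \<times> J. fst (case p of (i, j) \<Rightarrow> f i + g j) \<le> N}
      \<subseteq> {i \<in> I. fst (f i) \<le> N} \<times> {j \<in> J. fst (g j) \<le> N}"
  proof clarsimp
    fix i j assume "i \<in> I" "j \<in> J" "fst (f i) + fst (g j) \<le> N"
    moreover have "0 \<le> fst (f i)" "0 \<le> fst (g j)"
      using assms calculation by (auto simp: q_proper_def)
    ultimately show "fst (f i) \<le> N \<and> fst (g j) \<le> N" by linarith
  qed
  then show "finite {p \<in> I \<times> J. fst (case p of (i, j) \<Rightarrow> f i + g j) \<le> N}"
    by (rule finite_subset) (use assms in \<open>auto simp: q_proper_def\<close>)
next
  fix p assume "p \<in> I \<times> J"
  then show "0 \<le> fst (case p of (i, j) \<Rightarrow> f i + g j)"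
    using assms by (auto simp: q_proper_def)
qed

text \<open>A coefficient can be nonzero only at a value of \<open>f\<close>, so local finiteness
  puts the coefficient function into the domain of \<open>Abs_qseries\<close>.\<close>

lemma qcoeff_family_series:
  assumes "q_proper I f"
  shows "qcoeff (family_series I f \<phi>) m = (\<Sum>i | i \<in> I \<and> f i = m. \<phi> i)"
proof -
  let ?c = "\<lambda>m. \<Sum>i | i \<in> I \<and> f i = m. \<phi> i"
  have "qfin ?c"
    unfolding qfin_def
  proof
    fix N
    have "{m. ?c m \<noteq> 0 \<and> fst m \<le> N} \<subseteq> f ` {i \<in> I. fst (f i) \<le> N}"
    proof
      fix m assume m: "m \<in> {m. ?c m \<noteq> 0 \<and> fst m \<le> N}"
      then have "{i. i \<in> I \<and> f i = m} \<noteq> {}"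
        by (metis (mono_tags, lifting) mem_Collect_eq sum.empty)
      then show "m \<in> f ` {i \<in> I. fst (f i) \<le> N}" using m by auto
    qed
    then show "finite {m. ?c m \<noteq> 0 \<and> fst m \<le> N}"
      by (rule finite_subset) (use assms in \<open>auto simp: q_proper_def\<close>)
  qed
  then show ?thesis by (simp add: family_series_def Abs_qseries_inverse)
qed

text \<open>Both sides sort one finite sum over the pairs with \<open>f i + g j = m\<close>; the
  convolution groups it first by the two values and then by their fibres.\<close>

lemma family_series_mult:
  assumes I: "q_proper I f" and J: "q_proper J g"
  shows "family_series I f \<phi> * family_series J g \<psi>
    = family_series (I \<times> J) (\<lambda>(i, j). f i + g j) (\<lambda>(i, j). \<phi> i * \<psi> j)"
proof (rule qseries_eqI)
  fix m :: monomial
  let ?F = "\<lambda>a. \<Sum>i | i \<in> I \<and> f i = a. \<phi> i" and ?G = "\<lambda>b. \<Sum>j | j \<in> J \<and> g j = b. \<psi> j"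
  \<comment> \<open>As degrees are nonnegative, a pair that contributes to \<open>m\<close> has both
    degrees at most \<open>fst m\<close>. The truncated index sets are finite.\<close>
  define I' where "I' = {i \<in> I. fst (f i) \<le> fst m}"
  define J' where "J' = {j \<in> J. fst (g j) \<le> fst m}"
  have fin: "finite I'" "finite J'" using I J by (auto simp: I'_def J'_def q_proper_def)
  have pos: "i \<in> I \<Longrightarrow> 0 \<le> fst (f i)" "j \<in> J \<Longrightarrow> 0 \<le> fst (g j)" for i j
    using I J by (auto simp: q_proper_def)
  have in': "i \<in> I' \<and> j \<in> J'" if "i \<in> I" "j \<in> J" "f i + g j = m" for i j
  proof -
    have "fst (f i) + fst (g j) = fst m" using that(3) by auto
    then show ?thesis using pos that by (force simp: I'_def J'_def)
  qed
  have "qcoeff (family_series I f \<phi> * family_series J g \<psi>) m = conv ?F ?G m"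
    unfolding times_qseries.rep_eq qcoeff_family_series[OF I, abs_def] qcoeff_family_series[OF J, abs_def] ..
  also have "\<dots> = (\<Sum>a\<in>f ` I'. \<Sum>b\<in>g ` J'. if a + b = m then ?F a * ?G b else 0)"
  proof (rule conv_eq)
    fix a b assume *: "a + b = m" "?F a \<noteq> 0" "?G b \<noteq> 0"
    obtain i where "i \<in> I" "f i = a" using *(2) by (metis (mono_tags, lifting) mem_Collect_eq sum.not_neutral_contains_not_neutral)
    moreover obtain j where "j \<in> J" "g j = b" using *(3) by (metis (mono_tags, lifting) mem_Collect_eq sum.not_neutral_contains_not_neutral)
    ultimately show "a \<in> f ` I' \<and> b \<in> g ` J'" using in'[of i j] *(1) by blast
  qed (use fin in auto)
  also have "\<dots> = (\<Sum>a\<in>f ` I'. \<Sum>b\<in>g ` J'. \<Sum>i | i \<in> I' \<and> f i = a. \<Sum>j | j \<in> J' \<and> g j = b.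
      if f i + g j = m then \<phi> i * \<psi> j else 0)"
  proof (intro sum.cong refl)
    fix a b assume "a \<in> f ` I'" "b \<in> g ` J'"
    \<comment> \<open>Truncation depends on the monomial alone, so the fibre over an attained value
      is not cut.\<close>
    then have "{i. i \<in> I \<and> f i = a} = {i. i \<in> I' \<and> f i = a}" "{j. j \<in> J \<and> g j = b} = {j. j \<in> J' \<and> g j = b}"
      by (auto simp: I'_def J'_def)
    then show "(if a + b = m then ?F a * ?G b else 0)
      = (\<Sum>i | i \<in> I' \<and> f i = a. \<Sum>j | j \<in> J' \<and> g j = b. if f i + g j = m then \<phi> i * \<psi> j else 0)"
      by (auto simp: sum_product intro!: sum.cong sum.neutral)
  qed
  also have "\<dots> = (\<Sum>a\<in>f ` I'. \<Sum>i | i \<in> I' \<and> f i = a. \<Sum>b\<in>g ` J'. \<Sum>j | j \<in> J' \<and> g j = b.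
      if f i + g j = m then \<phi> i * \<psi> j else 0)"
    by (intro sum.cong refl sum.swap)
  also have "\<dots> = (\<Sum>i\<in>I'. \<Sum>j\<in>J'. if f i + g j = m then \<phi> i * \<psi> j else 0)"
    unfolding sum.group[OF fin(2) finite_imageI[OF fin(2)] order_refl]
    by (rule sum.group[OF fin(1) finite_imageI[OF fin(1)] order_refl])
  also have "\<dots> = (\<Sum>p\<in>I' \<times> J'. if f (fst p) + g (snd p) = m then \<phi> (fst p) * \<psi> (snd p) else 0)"
    by (simp add: sum.cartesian_product case_prod_unfold)
  also have "\<dots> = (\<Sum>p | p \<in> I \<times> J \<and> f (fst p) + g (snd p) = m. \<phi> (fst p) * \<psi> (snd p))"
    by (rule sum.mono_neutral_cong_right) (use fin in' pos in \<open>auto simp: I'_def J'_def\<close>)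
  also have "\<dots> = qcoeff (family_series (I \<times> J) (\<lambda>(i, j). f i + g j) (\<lambda>(i, j). \<phi> i * \<psi> j)) m"
    using q_proper_Times[OF I J] by (simp add: qcoeff_family_series case_prod_unfold)
  finally show "qcoeff (family_series I f \<phi> * family_series J g \<psi>) m
    = qcoeff (family_series (I \<times> J) (\<lambda>(i, j). f i + g j) (\<lambda>(i, j). \<phi> i * \<psi> j)) m" .
qed

lemma family_series_mult3:
  assumes "q_proper I f" "q_proper J g" "q_proper L h"
  shows "family_series I f \<phi> * (family_series J g \<psi> * family_series L h \<theta>)
    = family_series (I \<times> J \<times> L) (\<lambda>(i, j, l). f i + (g j + h l)) (\<lambda>(i, j, l). \<phi> i * (\<psi> j * \<theta> l))"
  unfolding family_series_mult[OF assms(2,3)] family_series_mult[OF assms(1) q_proper_Times[OF assms(2,3)]]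
  by (simp add: case_prod_unfold)

lemma family_series_cong:
  assumes "\<And>i. i \<in> I \<Longrightarrow> f i = g i" "\<And>i. i \<in> I \<Longrightarrow> \<phi> i = \<psi> i"
  shows "family_series I f \<phi> = family_series I g \<psi>"
  unfolding family_series_def
  by (rule arg_cong[of _ _ Abs_qseries], rule ext, rule sum.cong) (use assms in auto)

text \<open>The change of summation variable used for negation, for multiplication by
  \<open>omega\<close> and for the Fourier transform.\<close>

lemma family_series_reindex:
  assumes "bij_betw h I J"
  shows "family_series J f \<phi> = family_series I (f \<circ> h) (\<phi> \<circ> h)"
  unfolding family_series_def
proof (rule arg_cong[of _ _ Abs_qseries], rule ext)
  fix m
  have "bij_betw h {i. i \<in> I \<and> (f \<circ> h) i = m} {j. j \<in> J \<and> f j = m}"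
    using assms by (auto simp: bij_betw_def inj_on_def)
  then show "(\<Sum>j | j \<in> J \<and> f j = m. \<phi> j) = (\<Sum>i | i \<in> I \<and> (f \<circ> h) i = m. (\<phi> \<circ> h) i)"
    by (simp add: sum.reindex_bij_betw[symmetric])
qed

lemma family_series_add:
  assumes "q_proper I f"
  shows "family_series I f \<phi> + family_series I f \<psi> = family_series I f (\<lambda>i. \<phi> i + \<psi> i)"
  by (rule qseries_eqI) (simp add: qcoeff_add qcoeff_family_series assms sum.distrib)

lemma family_series_Un:
  assumes "q_proper I f" "q_proper J f" "I \<inter> J = {}"
  shows "family_series (I \<union> J) f \<phi> = family_series I f \<phi> + family_series J f \<phi>"
proof (rule qseries_eqI)
  fix m
  have "q_proper (I \<union> J) f"
    using assms by (auto simp: q_proper_def Collect_disj_eq conj_disj_distribR)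
  moreover have "{i. i \<in> I \<union> J \<and> f i = m} = {i. i \<in> I \<and> f i = m} \<union> {i. i \<in> J \<and> f i = m}" by auto
  moreover have "{i. i \<in> I \<and> f i = m} \<inter> {i. i \<in> J \<and> f i = m} = {}" using assms(3) by auto
  ultimately show "qcoeff (family_series (I \<union> J) f \<phi>) m
    = qcoeff (family_series I f \<phi> + family_series J f \<phi>) m"
    using assms by (simp add: qcoeff_add qcoeff_family_series sum.union_disjoint q_proper_finite)
qed

section \<open>Scalar multiples and restriction of the index set\<close>

lemma qcoeff_qconst_mult: "qcoeff (qconst c * f) m = c * qcoeff f m"
proof -
  have "qcoeff (qconst c * f) m
    = (\<Sum>a\<in>{unit_mon}. \<Sum>b\<in>{m}. if a + b = m then qcoeff (qconst c) a * qcoeff f b else 0)"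
    unfolding times_qseries.rep_eq
    by (rule conv_eq) (auto simp: unit_mon_def qconst_def qmonom.rep_eq split: if_splits)
  then show ?thesis by (simp add: unit_mon_def qconst_def qmonom.rep_eq)
qed

lemma qconst_family_series:
  assumes "q_proper I f"
  shows "qconst c * family_series I f \<phi> = family_series I f (\<lambda>i. c * \<phi> i)"
  by (rule qseries_eqI) (simp add: qcoeff_qconst_mult qcoeff_family_series assms sum_distrib_left)

lemma qconst_1: "qconst 1 = 1"
  by (rule qseries_eqI) (simp add: qconst_def qmonom.rep_eq one_qseries.rep_eq)

lemma qconst_add: "qconst (c + d) = qconst c + qconst d"
  by (rule qseries_eqI) (simp add: qconst_def qmonom.rep_eq qcoeff_add)

lemma qconst_3: "qconst 3 = 3"
  using qconst_add[of 1 2] qconst_add[of 1 1] by (simp add: qconst_1)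

text \<open>Turns the indicator function produced by a character sum into a condition on the
  indices.\<close>

lemma family_series_restrict:
  assumes "q_proper I f"
  shows "family_series I f (\<lambda>i. if P i then \<phi> i else 0) = family_series {i \<in> I. P i} f \<phi>"
proof (rule qseries_eqI)
  fix m
  have "q_proper {i \<in> I. P i} f" using assms by (rule q_proper_subset) auto
  moreover have "(\<Sum>i | i \<in> I \<and> f i = m. if P i then \<phi> i else 0)
      = (\<Sum>i | i \<in> {i \<in> I. P i} \<and> f i = m. \<phi> i)"
    by (rule sum.mono_neutral_cong_right) (use q_proper_finite[OF assms] in auto)
  ultimately show "qcoeff (family_series I f (\<lambda>i. if P i then \<phi> i else 0)) m
    = qcoeff (family_series {i \<in> I. P i} f \<phi>) m"
    using assms by (simp add: qcoeff_family_series)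
qed

section \<open>Eisenstein integers and their cubic character\<close>

lemma omega_squared: "omega\<^sup>2 = - 1 - omega"
  by (simp add: omega_eq complex_eq_iff power2_eq_square)

lemma omega_nonzero: "omega \<noteq> 0"
  by (simp add: omega_def)

lemma lam_mult_lam: "lam * (lam * x) = - 3 * x"
  using lam_squared by (simp add: power2_eq_square flip: mult.assoc)

lemma inverse_lam: "inverse lam = - lam / 3"
  using lam_squared lam_nonzero by (simp add: field_simps power2_eq_square)

lemma OK_of_int: "of_int n \<in> OK"
  unfolding OK_def by (rule CollectI, rule exI[of _ n], rule exI[of _ 0]) simp

lemma OK_omega: "omega \<in> OK"
  unfolding OK_def by (rule CollectI, rule exI[of _ 0], rule exI[of _ 1]) simp

lemma OK_uminus: "\<alpha> \<in> OK \<Longrightarrow> - \<alpha> \<in> OK"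
  using OK_diff[of 0 \<alpha>] OK_of_int[of 0] by simp

lemma OK_add: "\<alpha> \<in> OK \<Longrightarrow> \<beta> \<in> OK \<Longrightarrow> \<alpha> + \<beta> \<in> OK"
  using OK_diff[of \<alpha> "- \<beta>"] OK_uminus[of \<beta>] by simp

lemma OK_mult:
  assumes "\<alpha> \<in> OK" "\<beta> \<in> OK" shows "\<alpha> * \<beta> \<in> OK"
proof -
  obtain a b c d where ab: "\<alpha> = of_int a + of_int b * omega" "\<beta> = of_int c + of_int d * omega"
    using assms by (auto simp: OK_def)
  have "\<alpha> * \<beta> = of_int a * of_int c + (of_int a * of_int d + of_int b * of_int c) * omega
      + of_int b * of_int d * omega\<^sup>2"
    by (simp add: ab power2_eq_square algebra_simps)
  also have "\<dots> = of_int (a * c - b * d) + of_int (a * d + b * c - b * d) * omega"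
    by (simp add: omega_squared algebra_simps)
  finally show ?thesis unfolding OK_def by blast
qed

lemma OK_lam_mem: "lam \<in> OK"
  unfolding lam_def by (simp add: OK_diff OK_omega OK_mult power2_eq_square)

lemmas OK_intros = OK_add OK_diff OK_uminus OK_mult OK_omega OK_lam_mem OK_of_int

lemma chi_cong:
  assumes "\<alpha> \<in> OK" "\<beta> \<in> OK" "\<gamma> \<in> OK" "\<alpha> - \<beta> = lam * \<gamma>"
  shows "chi \<alpha> = chi \<beta>"
proof -
  obtain a \<delta> where a: "\<delta> \<in> OK" "\<beta> - of_int a = lam * \<delta>" using chi_exists[OF assms(2)] by auto
  have "\<alpha> - of_int a = lam * (\<gamma> + \<delta>)" using assms(4) a(2) by (simp add: algebra_simps)
  then show ?thesis using a assms chi_eq[of \<delta> \<beta> a] chi_eq[of "\<gamma> + \<delta>" \<alpha> a] OK_add by metis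
qed

lemma chi_of_int: "chi (of_int n) = omega powi n"
  using chi_eq[of 0 "of_int n" n] OK_of_int[of 0] by simp

lemma chi_add:
  assumes "\<alpha> \<in> OK" "\<beta> \<in> OK"
  shows "chi (\<alpha> + \<beta>) = chi \<alpha> * chi \<beta>"
proof -
  obtain a \<gamma> where a: "\<gamma> \<in> OK" "\<alpha> - of_int a = lam * \<gamma>" using chi_exists[OF assms(1)] by auto
  obtain b \<delta> where b: "\<delta> \<in> OK" "\<beta> - of_int b = lam * \<delta>" using chi_exists[OF assms(2)] by auto
  have "\<alpha> + \<beta> - of_int (a + b) = lam * (\<gamma> + \<delta>)" using a b by (simp add: algebra_simps)
  then have "chi (\<alpha> + \<beta>) = omega powi (a + b)" using chi_eq OK_add a b by blast
  then show ?thesis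
    using chi_eq[OF a] chi_eq[OF b] by (simp add: power_int_add omega_nonzero)
qed

lemma chi_nonzero: "chi \<alpha> \<noteq> 0"
  by (simp add: chi_def omega_nonzero)

lemma chi_cubed: "chi \<alpha> ^ 3 = 1"
proof -
  define a where "a = (SOME a. \<exists>\<beta>\<in>OK. \<alpha> - of_int a = lam * \<beta>)"
  have "chi \<alpha> ^ 3 = omega powi (a * 3)"
    by (simp add: chi_def a_def power_int_mult)
  also have "\<dots> = (omega powi 3) powi a"
    by (simp only: power_int_mult mult.commute[of a])
  finally show ?thesis using omega_cubed by simp
qed

lemma chi_uminus:
  assumes "\<alpha> \<in> OK" shows "chi (- \<alpha>) = inverse (chi \<alpha>)"
proof -
  have "chi (- \<alpha>) * chi \<alpha> = 1"
    using chi_add[of "- \<alpha>" \<alpha>] chi_of_int[of 0] assms OK_uminus by simp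
  then show ?thesis by (simp add: inverse_eq_divide eq_divide_eq chi_nonzero)
qed

text \<open>Only the exponent modulo 3 matters, and neither \<open>omega\<close> nor its square is
  1.\<close>

lemma omega_powi_eq_1_iff: "omega powi n = 1 \<longleftrightarrow> 3 dvd n"
proof -
  have "omega powi n = omega powi (3 * (n div 3) + n mod 3)" by simp
  also have "\<dots> = (omega powi 3) powi (n div 3) * omega powi (n mod 3)"
    by (simp only: power_int_add[OF disjI1[OF omega_nonzero]] power_int_mult)
  finally have *: "omega powi n = omega powi (n mod 3)" using omega_cubed by simp
  have "n mod 3 = 0 \<or> n mod 3 = 1 \<or> n mod 3 = 2" by presburger
  moreover have "omega \<noteq> 1" "omega\<^sup>2 \<noteq> 1"
    by (simp_all add: omega_eq complex_eq_iff power2_eq_square)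
  ultimately show ?thesis using * by (auto simp: dvd_eq_mod_eq_0)
qed

lemma chi_eq_1_iff:
  assumes "\<alpha> \<in> OK"
  shows "chi \<alpha> = 1 \<longleftrightarrow> (\<exists>\<beta>\<in>OK. \<alpha> = lam * \<beta>)"
proof
  assume "chi \<alpha> = 1"
  obtain a \<gamma> where a: "\<gamma> \<in> OK" "\<alpha> - of_int a = lam * \<gamma>" using chi_exists[OF assms] by auto
  then have "3 dvd a" using \<open>chi \<alpha> = 1\<close> chi_eq omega_powi_eq_1_iff by metis
  then obtain b where "a = 3 * b" by blast
  \<comment> \<open>The integer part \<open>3 * b\<close> is itself a multiple of
    \<open>lam\<close>, because \<open>3 = - lam * lam\<close>.\<close>
  then have "\<alpha> = lam * (\<gamma> - lam * of_int b)"
    using a(2) by (simp add: lam_mult_lam algebra_simps)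
  then show "\<exists>\<beta>\<in>OK. \<alpha> = lam * \<beta>" using a(1) by (blast intro: OK_intros)
next
  assume "\<exists>\<beta>\<in>OK. \<alpha> = lam * \<beta>"
  then show "chi \<alpha> = 1" using chi_eq[of _ \<alpha> 0] by auto
qed

text \<open>Orthogonality for the characters of Z/3Z, with exponents 0, 1, -1 as in the theorem. For
  \<open>x \<noteq> 1\<close> the factor \<open>x - 1\<close> of \<open>x ^ 3 - 1\<close>
  cancels.\<close>

lemma sum_cubic_roots:
  assumes "(x :: complex) ^ 3 = 1"
  shows "1 + x + inverse x = (if x = 1 then 3 else 0)"
proof (cases "x = 1")
  case False
  have "x \<noteq> 0" using assms by auto
  have "(x - 1) * (1 + x + x\<^sup>2) = 0"
    using assms by (simp add: algebra_simps power2_eq_square power3_eq_cube)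
  then have "1 + x + x\<^sup>2 = 0" using False by simp
  moreover have "inverse x = x\<^sup>2"
    using assms \<open>x \<noteq> 0\<close> by (simp add: field_simps power2_eq_square power3_eq_cube)
  ultimately show ?thesis using False by simp
qed simp

section \<open>Cosets of the ring of integers in its inverse different\<close>

lemma OK_coset_0: "OK_coset 0 = OK"
  by (simp add: OK_coset_def)

lemma OK_coset_iff: "\<alpha> \<in> OK_coset s \<longleftrightarrow> \<alpha> - of_int s / lam \<in> OK"
  by (auto simp: OK_coset_def intro!: exI[of _ "\<alpha> - of_int s / lam"])

text \<open>Subtracting the two integral parts leaves \<open>(s - r) / lam\<close> in
  \<open>OK\<close>, and an integer divisible by \<open>lam\<close> is divisible by 3.\<close>

lemma OK_coset_disjoint:
  assumes "\<alpha> \<in> OK_coset r" "\<alpha> \<in> OK_coset s"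
  shows "3 dvd s - r"
proof -
  have "(\<alpha> - of_int r / lam) - (\<alpha> - of_int s / lam) \<in> OK"
    using assms OK_diff unfolding OK_coset_iff by blast
  then show ?thesis
    by (intro int_lam_OK[of _ "(\<alpha> - of_int r / lam) - (\<alpha> - of_int s / lam)"])
       (simp_all add: lam_nonzero field_simps)
qed

text \<open>If \<alpha> is congruent to the integer a modulo \<open>lam\<close>, then
  \<open>\<alpha> / lam\<close> lies in the coset of \<open>a / lam\<close>. Only a modulo 3
  matters, since \<open>3 / lam = - lam\<close>.\<close>

lemma lam_inverse_OK_cosets:
  assumes "\<alpha> \<in> OK"
  shows "\<exists>s\<in>{0, 1, -1}. \<alpha> / lam \<in> OK_coset s"
proof -
  obtain a \<gamma> where a: "\<gamma> \<in> OK" "\<alpha> - of_int a = lam * \<gamma>" using chi_exists[OF assms] by auto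
  obtain s b where s: "s \<in> {0, 1, -1}" "a = s + 3 * b"
  proof -
    \<comment> \<open>Shifting by one before and after the reduction gives the balanced residue in
      {0, 1, -1}.\<close>
    have "a = (a + 1) mod 3 - 1 + 3 * ((a + 1) div 3)" by presburger
    moreover have "(a + 1) mod 3 - 1 \<in> {0, 1, -1}" by auto
    ultimately show ?thesis using that by blast
  qed
  have "\<alpha> / lam = \<gamma> - lam * of_int b + of_int s / lam"
    using a(2) s(2) lam_nonzero by (simp add: lam_mult_lam field_simps)
  moreover have "\<gamma> - lam * of_int b \<in> OK" using a(1) by (intro OK_intros)
  ultimately show ?thesis using s(1) unfolding OK_coset_def by blast
qed

section \<open>Theta series twisted by the cubic character\<close>

lemma theta_mon_zw:
  "theta_mon var_q var_z var_w \<alpha> = (to_rat ((cmod \<alpha>)\<^sup>2), to_rat (T \<alpha>), to_rat (T (\<alpha> / lam)))"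
  by (simp add: theta_mon_def mpow_def var_q_def var_z_def var_w_def)

lemma theta_mon_wz:
  "theta_mon var_q var_w (mpow var_z (- 3)) \<alpha>
    = (to_rat ((cmod \<alpha>)\<^sup>2), - 3 * to_rat (T (\<alpha> / lam)), to_rat (T \<alpha>))"
  by (simp add: theta_mon_def mpow_def var_q_def var_z_def var_w_def)

lemma theta_mon_1:
  "theta_mon var_q unit_mon unit_mon \<alpha> = (to_rat ((cmod \<alpha>)\<^sup>2), 0, 0)"
  by (simp add: theta_mon_def mpow_def var_q_def unit_mon_def zero_prod_def)

lemma theta_eq_family_series: "theta S \<psi> X Y Z = family_series S (theta_mon X Y Z) \<psi>"
  by (simp add: theta_def family_series_def)

text \<open>As \<open>Y\<close> and \<open>Z\<close> are free of q, the q-degree is the squared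
  norm, and a disc contains finitely many points of the coset.\<close>

lemma q_proper_OK_coset:
  assumes "fst Y = 0" "fst Z = 0"
  shows "q_proper (OK_coset s) (theta_mon var_q Y Z)"
proof -
  have fst: "fst (theta_mon var_q Y Z \<alpha>) = to_rat ((cmod \<alpha>)\<^sup>2)" for \<alpha>
    by (simp add: theta_mon_def assms) (simp add: var_q_def)
  have norm: "(cmod \<alpha>)\<^sup>2 = of_rat (fst (theta_mon var_q Y Z \<alpha>))" if "\<alpha> \<in> OK_coset s" for \<alpha>
    unfolding fst by (rule norm_squared_rat[symmetric]) (use that OK_coset_subset_K in blast)
  show ?thesis
    unfolding q_proper_def
  proof (intro conjI allI ballI)
    fix N
    show "finite {\<alpha> \<in> OK_coset s. fst (theta_mon var_q Y Z \<alpha>) \<le> N}"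
      by (rule finite_subset[OF _ finite_OK_coset_norm[of s "of_rat N"]])
         (auto simp: norm of_rat_less_eq)
  next
    fix \<alpha> assume "\<alpha> \<in> OK_coset s"
    then have "0 \<le> (of_rat (fst (theta_mon var_q Y Z \<alpha>)) :: real)" by (simp flip: norm)
    then show "0 \<le> fst (theta_mon var_q Y Z \<alpha>)" by simp
  qed
qed

lemma q_proper_zw: "q_proper (OK_coset s) (theta_mon var_q var_z var_w)"
  and q_proper_wz: "q_proper (OK_coset s) (theta_mon var_q var_w (mpow var_z (- 3)))"
  and q_proper_1: "q_proper (OK_coset s) (theta_mon var_q unit_mon unit_mon)"
  by (rule q_proper_OK_coset; simp add: var_z_def var_w_def unit_mon_def)+

text \<open>A common form of all series in the theorem: (s, j) = (0, 0) gives a, (0, j) gives b_j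
  and (s, 0) gives c_s. Subtracting \<open>s / lam\<close> moves the argument of \<open>chi\<close>
  into \<open>OK\<close>, where the character is meaningful.\<close>

definition twisted_theta :: "int \<Rightarrow> int \<Rightarrow> monomial \<Rightarrow> monomial \<Rightarrow> qseries" where
  "twisted_theta s j Y Z =
     family_series (OK_coset s) (theta_mon var_q Y Z) (\<lambda>\<alpha>. chi (\<alpha> - of_int s / lam) powi j)"

lemma ser_b_eq: "ser_b j var_q Y Z = twisted_theta 0 j Y Z"
  by (simp add: ser_b_def twisted_theta_def theta_eq_family_series OK_coset_0)

lemma ser_c_eq: "ser_c s var_q Y Z = twisted_theta s 0 Y Z"
  by (simp add: ser_c_def twisted_theta_def theta_eq_family_series)

lemma ser_a_eq: "ser_a var_q Y Z = twisted_theta 0 0 Y Z"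
  by (simp add: ser_a_def twisted_theta_def theta_eq_family_series OK_coset_0)

text \<open>Negation preserves the norm, exchanges the cosets of s and -s and inverts
  \<open>chi\<close>. This identifies b_{-1}(q) with b(q) and c_{-1}(q) with c(q).\<close>

lemma twisted_theta_uminus:
  "twisted_theta (- s) (- j) unit_mon unit_mon = twisted_theta s j unit_mon unit_mon"
proof -
  have bij: "bij_betw uminus (OK_coset s) (OK_coset (- s))"
  proof (rule bij_betwI[of _ _ _ uminus])
    have "- \<alpha> \<in> OK_coset (- r)" if "\<alpha> \<in> OK_coset r" for \<alpha> r
      using OK_uminus[of "\<alpha> - of_int r / lam"] that by (simp add: OK_coset_iff)
    from this[of _ s] this[of _ "- s"]
    show "uminus \<in> OK_coset s \<rightarrow> OK_coset (- s)" "uminus \<in> OK_coset (- s) \<rightarrow> OK_coset s"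
      by auto
  qed auto
  show ?thesis
    unfolding twisted_theta_def family_series_reindex[OF bij]
  proof (rule family_series_cong)
    fix \<alpha> assume "\<alpha> \<in> OK_coset s"
    then have "chi (- (\<alpha> - of_int s / lam)) = inverse (chi (\<alpha> - of_int s / lam))"
      by (intro chi_uminus) (simp add: OK_coset_iff)
    then show "((\<lambda>\<alpha>. chi (\<alpha> - of_int (- s) / lam) powi - j) \<circ> uminus) \<alpha>
      = chi (\<alpha> - of_int s / lam) powi j"
      by (simp add: power_int_minus power_int_inverse)
  qed (simp add: theta_mon_1)
qed

text \<open>Multiplication by \<open>\<omega>\<close> permutes \<open>\<O> + s/\<lambda>\<close> and multiplies the character by \<open>\<omega>\<^sup>-\<^sup>s\<close>,
  since \<open>(\<omega> - 1)/\<lambda> = -\<omega>\<^sup>2 \<equiv> -1\<close>.\<close>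

lemma twisted_theta_eq_0:
  assumes "\<not> 3 dvd s * j"
  shows "twisted_theta s j unit_mon unit_mon = 0"
proof -
  let ?\<Theta> = "twisted_theta s j unit_mon unit_mon"
  have shift: "omega * \<alpha> - of_int s / lam = omega * (\<alpha> - of_int s / lam) - of_int s * omega\<^sup>2" for \<alpha>
  proof -
    have "omega - 1 = - lam * omega\<^sup>2"
      by (simp add: lam_eq omega_eq complex_eq_iff power2_eq_square)
    then have "of_int s * (omega - 1) / lam = - of_int s * omega\<^sup>2"
      using lam_nonzero by simp
    then show ?thesis by (simp add: diff_divide_distrib algebra_simps)
  qed
  have mem: "omega * \<alpha> \<in> OK_coset s" if "\<alpha> \<in> OK_coset s" for \<alpha>
  proof -
    have "\<alpha> - of_int s / lam \<in> OK" using that by (simp only: OK_coset_iff)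
    then show ?thesis
      unfolding OK_coset_iff shift power2_eq_square
      by (rule OK_diff[OF OK_mult[OF OK_omega] OK_mult[OF OK_of_int OK_mult[OF OK_omega OK_omega]]])
  qed
  have bij: "bij_betw ((*) omega) (OK_coset s) (OK_coset s)"
  \<comment> \<open>The inverse is multiplication by \<open>omega\<^sup>2\<close>, as
    \<open>omega ^ 3 = 1\<close>.\<close>
  proof (rule bij_betwI[of _ _ _ "\<lambda>\<alpha>. omega * (omega * \<alpha>)"])
    have "omega * (omega * (omega * \<alpha>)) = \<alpha>" for \<alpha>
      using omega_cubed by (simp add: power3_eq_cube flip: mult.assoc)
    then show "omega * (omega * (omega * \<alpha>)) = \<alpha>" "omega * (omega * (omega * \<alpha>)) = \<alpha>" for \<alpha>
      by auto
  qed (auto simp: mem)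
  have "?\<Theta> = family_series (OK_coset s) (theta_mon var_q unit_mon unit_mon)
      (\<lambda>\<alpha>. omega powi (- (s * j)) * chi (\<alpha> - of_int s / lam) powi j)"
    unfolding twisted_theta_def
  proof (subst family_series_reindex[OF bij], rule family_series_cong)
    fix \<alpha> assume \<alpha>: "\<alpha> \<in> OK_coset s"
    define \<beta> where "\<beta> = \<alpha> - of_int s / lam"
    have \<beta>: "\<beta> \<in> OK" using \<alpha> by (simp add: \<beta>_def OK_coset_iff)
    \<comment> \<open>Both \<open>omega\<close> and its square are 1 modulo \<open>lam\<close>; the
      quotients come from \<open>omega - 1 = - lam * omega\<^sup>2\<close> and
      \<open>1 - omega\<^sup>2 = - lam * omega\<close>.\<close>
    have "omega * \<beta> - of_int s * omega\<^sup>2 - (\<beta> - of_int s)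
        = lam * (- omega * omega * \<beta> - of_int s * omega)"
      by (simp add: lam_eq omega_eq complex_eq_iff power2_eq_square field_simps)
    then have "chi (omega * \<beta> - of_int s * omega\<^sup>2) = chi (\<beta> + of_int (- s))"
      by (intro chi_cong[where \<gamma> = "- omega * omega * \<beta> - of_int s * omega"])
         (auto simp: power2_eq_square intro!: OK_intros \<beta>)
    also have "\<dots> = chi \<beta> * omega powi (- s)"
      by (simp only: chi_add[OF \<beta> OK_of_int] chi_of_int)
    finally have "chi (omega * \<alpha> - of_int s / lam) = omega powi (- s) * chi \<beta>"
      by (simp add: shift \<beta>_def mult.commute)
    then show "((\<lambda>\<alpha>. chi (\<alpha> - of_int s / lam) powi j) \<circ> (*) omega) \<alpha>
        = omega powi (- (s * j)) * chi (\<alpha> - of_int s / lam) powi j"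
      by (simp only: o_apply \<beta>_def power_int_mult_distrib power_int_mult minus_mult_left)
  next
    have "cmod omega = 1" by (simp add: omega_eq cmod_def power_divide)
    then show "(theta_mon var_q unit_mon unit_mon \<circ> (*) omega) \<alpha>
      = theta_mon var_q unit_mon unit_mon \<alpha>" for \<alpha>
      by (simp add: theta_mon_1 norm_mult)
  qed
  also have "\<dots> = qconst (omega powi (- (s * j))) * ?\<Theta>"
    unfolding twisted_theta_def qconst_family_series[OF q_proper_1] ..
  finally have eq: "?\<Theta> = qconst (omega powi (- (s * j))) * ?\<Theta>" .
  have ne: "omega powi (- (s * j)) \<noteq> 1"
    using assms by (simp only: omega_powi_eq_1_iff dvd_minus_iff not_False_eq_True)
  show ?thesis
  proof (rule qseries_eqI)
    fix m
    have "qcoeff ?\<Theta> m = omega powi (- (s * j)) * qcoeff ?\<Theta> m"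
      by (subst eq) (rule qcoeff_qconst_mult)
    then show "qcoeff ?\<Theta> m = qcoeff 0 m" using ne by (simp add: zero_qseries.rep_eq)
  qed
qed

section \<open>The discrete Fourier transform on triples\<close>

definition mon3 :: "complex \<times> complex \<times> complex \<Rightarrow> monomial" where
  "mon3 = (\<lambda>(x, y, z). theta_mon var_q var_z var_w x
     + (theta_mon var_q var_z var_w y + theta_mon var_q var_z var_w z))"

text \<open>Only u carries z and w, so a sum over a product set splits into a series in q, w, z^{-3}
  and two series in q alone.\<close>

definition mon3_dual :: "complex \<times> complex \<times> complex \<Rightarrow> monomial" where
  "mon3_dual = (\<lambda>(u, v, t). theta_mon var_q var_w (mpow var_z (- 3)) u
     + (theta_mon var_q unit_mon unit_mon v + theta_mon var_q unit_mon unit_mon t))"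

definition coset3 :: "int \<Rightarrow> (complex \<times> complex \<times> complex) set" where
  "coset3 s = OK_coset s \<times> OK_coset s \<times> OK_coset s"

definition dft :: "complex \<times> complex \<times> complex \<Rightarrow> complex \<times> complex \<times> complex" where
  "dft = (\<lambda>(x, y, z). ((x + y + z) / lam, (x + omega * y + omega\<^sup>2 * z) / lam,
                        (x + omega\<^sup>2 * y + omega * z) / lam))"

text \<open>The conjugate transpose of the matrix of \<open>dft\<close>: conjugation exchanges
  \<open>omega\<close> with its square and turns \<open>1 / lam\<close> into
  \<open>- 1 / lam\<close>.\<close>

definition inv_dft :: "complex \<times> complex \<times> complex \<Rightarrow> complex \<times> complex \<times> complex" where
  "inv_dft = (\<lambda>(u, v, t). (- (u + v + t) / lam, - (u + omega\<^sup>2 * v + omega * t) / lam,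
                            - (u + omega * v + omega\<^sup>2 * t) / lam))"

definition coset3_shift :: "int \<Rightarrow> complex \<times> complex \<times> complex \<Rightarrow> complex" where
  "coset3_shift s = (\<lambda>(u, v, t). (u - of_int s / lam) + (v - of_int s / lam) + (t - of_int s / lam))"

lemma q_proper_mon3: "q_proper (coset3 s) mon3"
  using q_proper_Times[OF q_proper_zw q_proper_Times[OF q_proper_zw q_proper_zw]]
  by (simp add: coset3_def mon3_def case_prod_unfold)

lemma q_proper_mon3_dual: "q_proper (coset3 s) mon3_dual"
  using q_proper_Times[OF q_proper_wz q_proper_Times[OF q_proper_1 q_proper_1]]
  by (simp add: coset3_def mon3_dual_def case_prod_unfold)

lemma dft_inv_dft: "dft (inv_dft p) = p" and inv_dft_dft: "inv_dft (dft p) = p"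
  unfolding dft_def inv_dft_def divide_inverse inverse_lam
  by (cases p; simp add: omega_eq lam_eq complex_eq_iff power2_eq_square field_simps)+

text \<open>The differences v - u and t - u involve only
  \<open>(omega - 1) / lam = - omega\<^sup>2\<close> and
  \<open>(omega\<^sup>2 - 1) / lam = omega\<close>, which are integral. Hence the coset of u
  determines those of v and t.\<close>

lemma dft_mem:
  assumes p: "p \<in> coset3 k" and s: "fst (dft p) \<in> OK_coset s"
  shows "dft p \<in> coset3 s" "chi (coset3_shift s (dft p) + of_int k) = 1"
proof -
  obtain x y z where xyz: "p = (x, y, z)" by (cases p)
  define a b c where "a = x - of_int k / lam" and "b = y - of_int k / lam" and "c = z - of_int k / lam"
  define e where "e = (x + y + z) / lam - of_int s / lam"
  have OK: "a \<in> OK" "b \<in> OK" "c \<in> OK" "e \<in> OK"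
    using p s by (simp_all add: xyz coset3_def a_def b_def c_def e_def dft_def OK_coset_iff)
  \<comment> \<open>The parts \<open>k / lam\<close> of y and z together contribute
    \<open>k * (omega - omega\<^sup>2) / lam = k\<close>.\<close>
  have 2: "(x + omega * y + omega\<^sup>2 * z) / lam - of_int s / lam
      = e + of_int k - omega * omega * b + omega * c"
    unfolding e_def a_def b_def c_def divide_inverse inverse_lam
    by (simp add: omega_eq lam_eq complex_eq_iff power2_eq_square field_simps)
  have 3: "(x + omega\<^sup>2 * y + omega * z) / lam - of_int s / lam
      = e + of_int k - omega * omega * c + omega * b"
    unfolding e_def a_def b_def c_def divide_inverse inverse_lam
    by (simp add: omega_eq lam_eq complex_eq_iff power2_eq_square field_simps)
  show mem: "dft p \<in> coset3 s"
    using s unfolding xyz dft_def coset3_def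
    by (simp add: OK_coset_iff 2 3) (intro conjI OK_intros OK)
  have "coset3_shift s (dft p) + of_int k = e + (e + of_int k - omega * omega * b + omega * c)
      + (e + of_int k - omega * omega * c + omega * b) + of_int k"
    unfolding xyz dft_def coset3_shift_def prod.case 2 3 e_def ..
  \<comment> \<open>The coefficient of b and of c is \<open>omega - omega\<^sup>2 = lam\<close>, and
    \<open>3 * (e + k)\<close> is divisible by \<open>lam\<close> because
    \<open>3 = - lam * lam\<close>.\<close>
  also have "\<dots> = lam * (- (lam * (e + of_int k)) + b + c)"
    by (simp add: omega_eq lam_eq complex_eq_iff power2_eq_square field_simps)
  finally have eq: "coset3_shift s (dft p) + of_int k = lam * (- (lam * (e + of_int k)) + b + c)" .
  have "- (lam * (e + of_int k)) + b + c \<in> OK" by (intro OK_intros OK)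
  then show "chi (coset3_shift s (dft p) + of_int k) = 1"
    unfolding eq by (subst chi_eq_1_iff) (auto intro: OK_intros)
qed

lemma inv_dft_mem:
  assumes p: "p \<in> coset3 s" and chi: "chi (coset3_shift s p + of_int k) = 1"
  shows "inv_dft p \<in> coset3 k"
proof -
  obtain u v t where uvt: "p = (u, v, t)" by (cases p)
  define e f g where "e = u - of_int s / lam" and "f = v - of_int s / lam" and "g = t - of_int s / lam"
  have OK: "e \<in> OK" "f \<in> OK" "g \<in> OK"
    using p by (simp_all add: uvt coset3_def e_def f_def g_def OK_coset_iff)
  have "chi (e + f + g + of_int k) = 1"
    using chi by (simp add: uvt coset3_shift_def e_def f_def g_def)
  then obtain \<beta> where \<beta>: "\<beta> \<in> OK" "e + f + g + of_int k = lam * \<beta>"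
    using chi_eq_1_iff[of "e + f + g + of_int k"] OK by (auto intro: OK_intros)
  \<comment> \<open>Eliminating e by the congruence makes the division by \<open>lam\<close> in
    \<open>inv_dft\<close> exact, up to the expected term \<open>k / lam\<close>.\<close>
  have e: "e = lam * \<beta> - f - g - of_int k" using \<beta>(2) by (simp add: algebra_simps)
  have u: "u = e + of_int s / lam" and v: "v = f + of_int s / lam" and t: "t = g + of_int s / lam"
    by (simp_all add: e_def f_def g_def)
  have sqrt3: "sqrt 3 * (sqrt 3 * x) = 3 * x" for x by (simp flip: mult.assoc)
  have "- (u + v + t) / lam - of_int k / lam = of_int s - \<beta>"
    "- (u + omega\<^sup>2 * v + omega * t) / lam - of_int k / lam = omega * omega * g - omega * f - \<beta>"
    "- (u + omega * v + omega\<^sup>2 * t) / lam - of_int k / lam = omega * omega * f - omega * g - \<beta>"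
    unfolding u v t e divide_inverse inverse_lam
    by (simp_all add: omega_eq lam_eq complex_eq_iff power2_eq_square field_simps sqrt3)
  then show ?thesis
    unfolding uvt inv_dft_def coset3_def
    by (simp add: OK_coset_iff) (intro conjI OK_intros OK \<beta>)
qed

lemma bij_betw_dft:
  "bij_betw dft {p \<in> coset3 k. fst (dft p) \<in> OK_coset s}
    {p \<in> coset3 s. chi (coset3_shift s p + of_int k) = 1}"
proof (rule bij_betwI[of _ _ _ inv_dft])
  have "fst p \<in> OK_coset s" if "p \<in> coset3 s" for p
    using that by (auto simp: coset3_def)
  then show "inv_dft \<in> {p \<in> coset3 s. chi (coset3_shift s p + of_int k) = 1}
      \<rightarrow> {p \<in> coset3 k. fst (dft p) \<in> OK_coset s}"
    by (auto simp: inv_dft_mem dft_inv_dft)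
qed (auto simp: dft_mem dft_inv_dft inv_dft_dft)

section \<open>Invariance of the monomials under the transform\<close>

lemma to_rat_norm_sum:
  assumes "x \<in> K" "y \<in> K" "z \<in> K" "u \<in> K" "v \<in> K" "t \<in> K"
    and "(cmod x)\<^sup>2 + (cmod y)\<^sup>2 + (cmod z)\<^sup>2 = (cmod u)\<^sup>2 + (cmod v)\<^sup>2 + (cmod t)\<^sup>2"
  shows "to_rat ((cmod x)\<^sup>2) + to_rat ((cmod y)\<^sup>2) + to_rat ((cmod z)\<^sup>2)
    = to_rat ((cmod u)\<^sup>2) + to_rat ((cmod v)\<^sup>2) + to_rat ((cmod t)\<^sup>2)"
proof -
  \<comment> \<open>\<open>to_rat\<close> respects sums only on rational values. Norms of elements
    of \<open>K\<close> are rational, so the identity can be checked after embedding into the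
    reals.\<close>
  have "(of_rat (to_rat ((cmod x)\<^sup>2) + to_rat ((cmod y)\<^sup>2) + to_rat ((cmod z)\<^sup>2)) :: real)
    = of_rat (to_rat ((cmod u)\<^sup>2) + to_rat ((cmod v)\<^sup>2) + to_rat ((cmod t)\<^sup>2))"
    unfolding of_rat_add norm_squared_rat[OF assms(1)] norm_squared_rat[OF assms(2)]
      norm_squared_rat[OF assms(3)] norm_squared_rat[OF assms(4)] norm_squared_rat[OF assms(5)]
      norm_squared_rat[OF assms(6)] by (rule assms(7))
  then show ?thesis by (simp only: of_rat_eq_iff)
qed

lemma to_rat_T_sum:
  assumes "x \<in> K" "y \<in> K" "z \<in> K" "u \<in> K" and "x + y + z = of_rat r * u"
  shows "to_rat (T x) + to_rat (T y) + to_rat (T z) = r * to_rat (T u)"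
proof -
  have "T x + T y + T z = T (of_rat r * u)" unfolding assms(5)[symmetric] by (simp add: T_def)
  also have "\<dots> = of_rat r * T u" by (simp add: T_def of_rat_complex algebra_simps)
  finally have "(of_rat (to_rat (T x) + to_rat (T y) + to_rat (T z)) :: complex) = of_rat (r * to_rat (T u))"
    by (simp only: of_rat_add of_rat_mult T_rat assms(1-4))
  then show ?thesis by (simp only: of_rat_eq_iff)
qed

text \<open>Parseval's identity for the cyclic group of order 3; the factor 3 is the squared norm of
  \<open>lam\<close>.\<close>

lemma dft_norm:
  "(cmod ((x + y + z) / lam))\<^sup>2 + (cmod ((x + omega * y + omega\<^sup>2 * z) / lam))\<^sup>2
     + (cmod ((x + omega\<^sup>2 * y + omega * z) / lam))\<^sup>2 = (cmod x)\<^sup>2 + (cmod y)\<^sup>2 + (cmod z)\<^sup>2"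
  (is "?L = _")
proof -
  have sqrt3: "sqrt 3 * (sqrt 3 * r) = 3 * r" for r by (simp flip: mult.assoc)
  have "(cmod lam)\<^sup>2 = 3" by (simp add: cmod_power2 lam_eq)
  then have div: "(cmod (\<alpha> / lam))\<^sup>2 = (cmod \<alpha>)\<^sup>2 / 3" for \<alpha>
    by (simp add: norm_divide power_divide)
  have "?L = ((cmod (x + y + z))\<^sup>2
      + (cmod (x + omega * y + (- 1 - omega) * z))\<^sup>2 + (cmod (x + (- 1 - omega) * y + omega * z))\<^sup>2) / 3"
    unfolding omega_squared div by (simp only: add_divide_distrib)
  also have "\<dots> = (cmod x)\<^sup>2 + (cmod y)\<^sup>2 + (cmod z)\<^sup>2"
    unfolding cmod_power2 by (simp add: omega_eq power2_eq_square algebra_simps sqrt3)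
  finally show ?thesis .
qed

lemma mon3_dual_dft:
  assumes p: "p \<in> coset3 k" and s: "fst (dft p) \<in> OK_coset s"
  shows "mon3_dual (dft p) = mon3 p"
proof -
  obtain x y z where xyz: "p = (x, y, z)" by (cases p)
  obtain u v t where uvt: "dft p = (u, v, t)" by (cases "dft p")
  have defs: "u = (x + y + z) / lam" "v = (x + omega * y + omega\<^sup>2 * z) / lam"
    "t = (x + omega\<^sup>2 * y + omega * z) / lam"
    using uvt by (simp_all add: xyz dft_def)
  have K: "x \<in> K" "y \<in> K" "z \<in> K" "u \<in> K" "v \<in> K" "t \<in> K"
    using p dft_mem(1)[OF p s] OK_coset_subset_K unfolding uvt unfolding xyz coset3_def by blast+
  have "(cmod x)\<^sup>2 + (cmod y)\<^sup>2 + (cmod z)\<^sup>2 = (cmod u)\<^sup>2 + (cmod v)\<^sup>2 + (cmod t)\<^sup>2"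
    unfolding defs by (rule dft_norm[symmetric])
  then have 1: "to_rat ((cmod x)\<^sup>2) + to_rat ((cmod y)\<^sup>2) + to_rat ((cmod z)\<^sup>2)
      = to_rat ((cmod u)\<^sup>2) + to_rat ((cmod v)\<^sup>2) + to_rat ((cmod t)\<^sup>2)"
    by (intro to_rat_norm_sum K)
  \<comment> \<open>The sum equals \<open>lam * u\<close>, and \<open>lam * lam = - 3\<close>: this
    is the origin of z^{-3}.\<close>
  have "x + y + z = of_rat (- 3) * (u / lam)"
    unfolding defs using lam_squared by (simp add: power2_eq_square of_rat_minus field_simps)
  then have 2: "to_rat (T x) + to_rat (T y) + to_rat (T z) = - 3 * to_rat (T (u / lam))"
    by (intro to_rat_T_sum divide_lam_K K)
  \<comment> \<open>The total exponent of w becomes \<open>T u\<close>, so z and w exchange their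
    roles.\<close>
  have "x / lam + y / lam + z / lam = of_rat 1 * u" by (simp add: defs add_divide_distrib)
  then have 3: "to_rat (T (x / lam)) + to_rat (T (y / lam)) + to_rat (T (z / lam)) = 1 * to_rat (T u)"
    by (intro to_rat_T_sum divide_lam_K K)
  show ?thesis
    unfolding uvt unfolding xyz mon3_def mon3_dual_def prod.case theta_mon_zw theta_mon_wz theta_mon_1
    using 1 2 3 by (simp add: add.assoc)
qed

section \<open>Assembly of the identity\<close>

lemma ser_c_cubed:
  "ser_c k var_q var_z var_w ^ 3
    = (\<Sum>s\<in>{0, 1, -1}. family_series {p \<in> coset3 s. chi (coset3_shift s p + of_int k) = 1} mon3_dual (\<lambda>_. 1))"
proof -
  define I where "I s = {p \<in> coset3 k. fst (dft p) \<in> OK_coset s}" for s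
  have proper: "q_proper (I s) mon3" for s
    by (rule q_proper_subset[OF q_proper_mon3]) (auto simp: I_def)
  have "fst (dft p) \<in> OK_coset 0 \<union> OK_coset 1 \<union> OK_coset (- 1)" if "p \<in> coset3 k" for p
  proof -
    obtain x y z where xyz: "p = (x, y, z)" by (cases p)
    define a b c where "a = x - of_int k / lam" and "b = y - of_int k / lam" and "c = z - of_int k / lam"
    have "a \<in> OK" "b \<in> OK" "c \<in> OK"
      using that by (simp_all add: xyz coset3_def a_def b_def c_def OK_coset_iff)
    then have "a + b + c - lam * of_int k \<in> OK" by (intro OK_intros)
    \<comment> \<open>The three shifts add up to \<open>3 * k / lam = - lam * k\<close>, so the sum
      is integral and its quotient by \<open>lam\<close> lies in one of the three cosets.\<close>
    moreover have "x + y + z = a + b + c - lam * of_int k"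
      unfolding a_def b_def c_def divide_inverse inverse_lam by simp
    ultimately show ?thesis using lam_inverse_OK_cosets[of "x + y + z"] by (simp add: xyz dft_def)
  qed
  then have cover: "coset3 k = I 0 \<union> I 1 \<union> I (- 1)" by (auto simp: I_def)
  have disj: "I r \<inter> I s = {}" if "\<not> 3 dvd s - r" for r s
    using OK_coset_disjoint that by (auto simp: I_def)
  have "ser_c k var_q var_z var_w ^ 3 = family_series (coset3 k) mon3 (\<lambda>_. 1)"
    unfolding ser_c_def theta_eq_family_series power3_eq_cube mult.assoc
      family_series_mult3[OF q_proper_zw q_proper_zw q_proper_zw] coset3_def mon3_def
    by (simp add: case_prod_unfold)
  also have "\<dots> = family_series (I 0) mon3 (\<lambda>_. 1) + family_series (I 1) mon3 (\<lambda>_. 1)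
      + family_series (I (- 1)) mon3 (\<lambda>_. 1)"
  proof -
    have "q_proper (I 0 \<union> I 1) mon3"
      by (rule q_proper_subset[OF q_proper_mon3]) (auto simp: I_def)
    moreover have "(I 0 \<union> I 1) \<inter> I (- 1) = {}" using disj[of "- 1" 0] disj[of "- 1" 1] by auto
    ultimately show ?thesis unfolding cover by (simp add: family_series_Un proper disj)
  qed
  finally have sum: "ser_c k var_q var_z var_w ^ 3 = family_series (I 0) mon3 (\<lambda>_. 1)
      + family_series (I 1) mon3 (\<lambda>_. 1) + family_series (I (- 1)) mon3 (\<lambda>_. 1)" .
  have "family_series (I s) mon3 (\<lambda>_. 1)
      = family_series {p \<in> coset3 s. chi (coset3_shift s p + of_int k) = 1} mon3_dual (\<lambda>_. 1)" for s
    unfolding family_series_reindex[OF bij_betw_dft] I_def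
    by (rule family_series_cong) (auto simp: mon3_dual_dft)
  then show ?thesis unfolding sum by (simp add: add.assoc)
qed

lemma twisted_theta_products:
  defines "A \<equiv> \<lambda>s j. twisted_theta s j var_w (mpow var_z (- 3))"
    and "B \<equiv> \<lambda>s j. twisted_theta s j unit_mon unit_mon"
  shows "A s 0 * (B s 0)\<^sup>2 + qconst (omega powi k) * A s 1 * (B s 1)\<^sup>2
      + qconst (omega powi (- k)) * A s (- 1) * (B s (- 1))\<^sup>2
    = 3 * family_series {p \<in> coset3 s. chi (coset3_shift s p + of_int k) = 1} mon3_dual (\<lambda>_. 1)"
proof -
  define w where "w p = chi (coset3_shift s p + of_int k)" for p
  have w: "w (u, v, t) = chi (u - of_int s / lam) * (chi (v - of_int s / lam) * chi (t - of_int s / lam))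
      * omega powi k" if "(u, v, t) \<in> coset3 s" for u v t
    using that unfolding w_def coset3_shift_def coset3_def prod.case mem_Times_iff fst_conv snd_conv OK_coset_iff
    by (simp only: chi_add OK_add OK_of_int chi_of_int mult.assoc)
  \<comment> \<open>The constant is the j-th power of \<open>chi\<close> at the integer k. By
    multiplicativity it merges with the three twists into a power of the single character value
    \<open>w p\<close>.\<close>
  have twist: "qconst (omega powi (j * k)) * A s j * (B s j)\<^sup>2
      = family_series (coset3 s) mon3_dual (\<lambda>p. w p powi j)" for j
  proof -
    have "qconst (omega powi (j * k)) * A s j * (B s j)\<^sup>2 = family_series (coset3 s) mon3_dual
      (\<lambda>(u, v, t). omega powi (j * k) * (chi (u - of_int s / lam) powi j
        * (chi (v - of_int s / lam) powi j * chi (t - of_int s / lam) powi j)))"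
      using q_proper_mon3_dual[of s]
      unfolding A_def B_def twisted_theta_def power2_eq_square mult.assoc
        family_series_mult3[OF q_proper_wz q_proper_1 q_proper_1]
        coset3_def[symmetric] mon3_dual_def[symmetric]
      by (simp add: qconst_family_series case_prod_unfold)
    also have "\<dots> = family_series (coset3 s) mon3_dual (\<lambda>p. w p powi j)"
      by (rule family_series_cong)
         (auto simp: w power_int_mult_distrib mult.commute[of j] power_int_mult)
    finally show ?thesis .
  qed
  have "A s 0 * (B s 0)\<^sup>2 + qconst (omega powi k) * A s 1 * (B s 1)\<^sup>2
      + qconst (omega powi (- k)) * A s (- 1) * (B s (- 1))\<^sup>2
    = family_series (coset3 s) mon3_dual (\<lambda>p. 1 + w p + inverse (w p))"
    using twist[of 0] twist[of 1] twist[of "- 1"]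
    by (simp add: qconst_1 family_series_add q_proper_mon3_dual power_int_minus)
  \<comment> \<open>\<open>w p\<close> is a cube root of unity, so orthogonality selects the
    congruence and yields the factor 3.\<close>
  also have "\<dots> = family_series (coset3 s) mon3_dual (\<lambda>p. if w p = 1 then 3 else 0)"
    by (simp only: sum_cubic_roots w_def chi_cubed)
  also have "\<dots> = qconst 3 * family_series {p \<in> coset3 s. w p = 1} mon3_dual (\<lambda>_. 1)"
    by (subst qconst_family_series)
       (auto intro: q_proper_subset[OF q_proper_mon3_dual] simp: family_series_restrict q_proper_mon3_dual)
  finally show ?thesis by (simp add: qconst_3 w_def)
qed

theorem theorem1:
  shows "(\<forall>k :: int.
      3 * (ser_c k var_q var_z var_w) ^ 3 =
          ser_a var_q var_w (mpow var_z (- 3)) * a_q\<^sup>2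
        + qconst (omega powi k) * ser_b 1 var_q var_w (mpow var_z (- 3)) * b_q\<^sup>2
        + qconst (omega powi (- k)) * ser_b (- 1) var_q var_w (mpow var_z (- 3)) * b_q\<^sup>2
        + ser_c 1 var_q var_w (mpow var_z (- 3)) * c_q\<^sup>2
        + ser_c (- 1) var_q var_w (mpow var_z (- 3)) * c_q\<^sup>2)
    \<and> 3 * (ser_a var_q var_z var_w) ^ 3 =
          ser_a var_q var_w (mpow var_z (- 3)) * a_q\<^sup>2
        + ser_b 1 var_q var_w (mpow var_z (- 3)) * b_q\<^sup>2
        + ser_b (- 1) var_q var_w (mpow var_z (- 3)) * b_q\<^sup>2
        + ser_c 1 var_q var_w (mpow var_z (- 3)) * c_q\<^sup>2
        + ser_c (- 1) var_q var_w (mpow var_z (- 3)) * c_q\<^sup>2"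
proof -
  let ?A = "\<lambda>s j. twisted_theta s j var_w (mpow var_z (- 3))"
  let ?B = "\<lambda>s j. twisted_theta s j unit_mon unit_mon"
  have main: "3 * (ser_c k var_q var_z var_w) ^ 3 =
          ser_a var_q var_w (mpow var_z (- 3)) * a_q\<^sup>2
        + qconst (omega powi k) * ser_b 1 var_q var_w (mpow var_z (- 3)) * b_q\<^sup>2
        + qconst (omega powi (- k)) * ser_b (- 1) var_q var_w (mpow var_z (- 3)) * b_q\<^sup>2
        + ser_c 1 var_q var_w (mpow var_z (- 3)) * c_q\<^sup>2
        + ser_c (- 1) var_q var_w (mpow var_z (- 3)) * c_q\<^sup>2" for k
  proof -
    have b: "?B 0 (- 1) = ?B 0 1" and c: "?B (- 1) 0 = ?B 1 0"
      using twisted_theta_uminus[of 0 1] twisted_theta_uminus[of 1 0] by simp_all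
    have "3 * (ser_c k var_q var_z var_w) ^ 3
        = (\<Sum>s\<in>{0, 1, -1}. ?A s 0 * (?B s 0)\<^sup>2 + qconst (omega powi k) * ?A s 1 * (?B s 1)\<^sup>2
      + qconst (omega powi (- k)) * ?A s (- 1) * (?B s (- 1))\<^sup>2)"
      unfolding ser_c_cubed twisted_theta_products by (simp add: sum_distrib_left)
    \<comment> \<open>Of the nine products the four with \<open>s * j\<close> equal to 1 or -1
      vanish; \<open>b\<close> and \<open>c\<close> bring the remaining squares to
      \<open>b_q\<close> and \<open>c_q\<close>.\<close>
    then show ?thesis
      by (simp add: twisted_theta_eq_0 b c ser_a_eq ser_b_eq ser_c_eq a_q_def b_q_def c_q_def
          add.assoc)
  qed
  moreover have "ser_c 0 var_q var_z var_w = ser_a var_q var_z var_w"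
    by (simp add: ser_a_eq ser_c_eq)
  ultimately show ?thesis using main[of 0] by (simp add: qconst_1)
qed

end
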